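(* Let $(E,\mathscr T)$ be a stable locally $L^0$-convex module and $U$ a stable neighbourhood of $0$ in $E$. Then the polar $$U^\circ=\{f\in E^*:f(x)\le1\text{ for all }x\in U\}$$ is stable compact with respect to $\sigma_s(E^*,E)$.
   Context: $L^0$: real measurable functions on a probability space modulo a.e. equality, a.e. order, $L^0_{++}=\{r>0\text{ a.e.}\}$. $E$ stable: for each countable measurable partition $(A_k)$ and $(x_k)\subset E$ there is a unique $x=\sum_k1_{A_k}x_k$ with $1_{A_k}x=1_{A_k}x_k$. Nonempty subsets closed under concatenations are stable; for stable $Y_k$, $\sum_k1_{A_k}Y_k=\{\sum_k1_{A_k}y_k:y_k\in Y_k\}$. An $L^0$-seminorm is $p:E\to L^0_+$, $p(rx)=|r|p(x)$, $p(x+y)\le p(x)+p(y)$; a collection $\mathscr P$ is stable if closed under $\sum_k1_{A_k}p_k$, separated if $\sup_pp(x)=0\Rightarrow x=0$. $\mathscr N\subset\mathscr P$ is stable finite if $\mathscr N=\{\sum_k1_{A_k}q_k:q_k\in\mathrm{st}(\mathscr N_k)\}$ with $\mathscr N_k\subset\mathscr P$ finite, $\mathrm{st}(\mathscr N_k)$ the concatenations of elements of $\mathscr N_k$. For a stable family $\mathscr P$, $\mathscr T_s(\mathscr P)$ is generated by $\{y:\sup_{p\in\mathscr N}p(x-y)<r\}$, $r\in L^0_{++}$, $\mathscr N$ stable finite. A stable locally $L^0$-convex module is stable $E$ with $\mathscr T=\mathscr T_s(\mathscr P)$ for a stable separated $\mathscr P$. $E^*$ is the stable $L^0$-module of continuous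 $L^0$-linear $f:E\to L^0$ ($L^0$ with base $\{s:|s-t|<r\}$). $\sigma_s(E^*,E)$ is the topology $\mathscr T_s$ on $E^*$ induced by the stable family of seminorms $\{f\mapsto|f(x)|:x\in E\}$. A filter is stable if it has a filter base which is a stable collection of stable sets; a stable set is stable compact if every stable filter on it has a cluster point in it. *)

theory Defs
  imports "HOL-Analysis.Analysis" "HOL-Probability.Probability"
begin

type_synonym 'a L0 = "('a \<Rightarrow> real) set"

definition cls :: "'a measure \<Rightarrow> ('a \<Rightarrow> real) \<Rightarrow> 'a L0" where
  "cls M f = {g \<in> borel_measurable M. AE \<omega> in M. f \<omega> = g \<omega>}"

definition L0 :: "'a measure \<Rightarrow> 'a L0 set" where
  "L0 M = {cls M f | f. f \<in> borel_measurable M}"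

definition rep :: "'a L0 \<Rightarrow> ('a \<Rightarrow> real)" where
  "rep r = (SOME f. f \<in> r)"

definition l0c :: "'a measure \<Rightarrow> real \<Rightarrow> 'a L0" where
  "l0c M c = cls M (\<lambda>_. c)"

definition l0_add :: "'a measure \<Rightarrow> 'a L0 \<Rightarrow> 'a L0 \<Rightarrow> 'a L0" where
  "l0_add M r s = cls M (\<lambda>\<omega>. rep r \<omega> + rep s \<omega>)"

definition l0_diff :: "'a measure \<Rightarrow> 'a L0 \<Rightarrow> 'a L0 \<Rightarrow> 'a L0" where
  "l0_diff M r s = cls M (\<lambda>\<omega>. rep r \<omega> - rep s \<omega>)"

definition l0_mul :: "'a measure \<Rightarrow> 'a L0 \<Rightarrow> 'a L0 \<Rightarrow> 'a L0" where
  "l0_mul M r s = cls M (\<lambda>\<omega>. rep r \<omega> * rep s \<omega>)"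

definition l0_abs :: "'a measure \<Rightarrow> 'a L0 \<Rightarrow> 'a L0" where
  "l0_abs M r = cls M (\<lambda>\<omega>. \<bar>rep r \<omega>\<bar>)"

definition l0_le :: "'a measure \<Rightarrow> 'a L0 \<Rightarrow> 'a L0 \<Rightarrow> bool" where
  "l0_le M r s = (AE \<omega> in M. rep r \<omega> \<le> rep s \<omega>)"

definition l0_less :: "'a measure \<Rightarrow> 'a L0 \<Rightarrow> 'a L0 \<Rightarrow> bool" where
  "l0_less M r s = (AE \<omega> in M. rep r \<omega> < rep s \<omega>)"

definition L0p :: "'a measure \<Rightarrow> 'a L0 set" where
  "L0p M = {r \<in> L0 M. l0_le M (l0c M 0) r}"

definition L0pp :: "'a measure \<Rightarrow> 'a L0 set" where
  "L0pp M = {r \<in> L0 M. l0_less M (l0c M 0) r}"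

definition l0_is_sup :: "'a measure \<Rightarrow> 'a L0 set \<Rightarrow> 'a L0 \<Rightarrow> bool" where
  "l0_is_sup M S s = (s \<in> L0 M \<and> (\<forall>r\<in>S. l0_le M r s) \<and>
     (\<forall>t\<in>L0 M. (\<forall>r\<in>S. l0_le M r t) \<longrightarrow> l0_le M s t))"

definition l0_ind :: "'a measure \<Rightarrow> 'a set \<Rightarrow> 'a L0" where
  "l0_ind M A = cls M (indicator A)"

text \<open>countable measurable partitions, indexed by nat (empty pieces allowed)\<close>
definition meas_part :: "'a measure \<Rightarrow> (nat \<Rightarrow> 'a set) \<Rightarrow> bool" where
  "meas_part M A = ((\<forall>k. A k \<in> sets M) \<and> disjoint_family A \<and> (\<Union>k. A k) = space M)"

definition l0_concat :: "'a measure \<Rightarrow> (nat \<Rightarrow> 'a set) \<Rightarrow> (nat \<Rightarrow> 'a L0) \<Rightarrow> 'a L0" where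
  "l0_concat M A r = cls M (\<lambda>\<omega>. rep (r (THE k. \<omega> \<in> A k)) \<omega>)"

definition L0top :: "'a measure \<Rightarrow> 'a L0 topology" where
  "L0top M = topology_generated_by
     {{s \<in> L0 M. l0_less M (l0_abs M (l0_diff M s t)) r} | t r. t \<in> L0 M \<and> r \<in> L0pp M}"

record ('a, 'e) l0mod =
  mcarrier :: "'e set"
  madd :: "'e \<Rightarrow> 'e \<Rightarrow> 'e"
  mzero :: 'e
  msmul :: "('a \<Rightarrow> real) set \<Rightarrow> 'e \<Rightarrow> 'e"

definition mdiff :: "'a measure \<Rightarrow> ('a, 'e) l0mod \<Rightarrow> 'e \<Rightarrow> 'e \<Rightarrow> 'e" where
  "mdiff M E x y = madd E x (msmul E (l0c M (-1)) y)"

definition l0_module :: "'a measure \<Rightarrow> ('a, 'e) l0mod \<Rightarrow> bool" where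
  "l0_module M E = (
     mzero E \<in> mcarrier E \<and>
     (\<forall>x\<in>mcarrier E. \<forall>y\<in>mcarrier E. madd E x y \<in> mcarrier E) \<and>
     (\<forall>r\<in>L0 M. \<forall>x\<in>mcarrier E. msmul E r x \<in> mcarrier E) \<and>
     (\<forall>x\<in>mcarrier E. \<forall>y\<in>mcarrier E. \<forall>z\<in>mcarrier E. madd E (madd E x y) z = madd E x (madd E y z)) \<and>
     (\<forall>x\<in>mcarrier E. \<forall>y\<in>mcarrier E. madd E x y = madd E y x) \<and>
     (\<forall>x\<in>mcarrier E. madd E x (mzero E) = x) \<and>
     (\<forall>x\<in>mcarrier E. madd E x (msmul E (l0c M (-1)) x) = mzero E) \<and>
     (\<forall>r\<in>L0 M. \<forall>x\<in>mcarrier E. \<forall>y\<in>mcarrier E. msmul E r (madd E x y) = madd E (msmul E r x) (msmul E r y)) \<and>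
     (\<forall>r\<in>L0 M. \<forall>s\<in>L0 M. \<forall>x\<in>mcarrier E. msmul E (l0_add M r s) x = madd E (msmul E r x) (msmul E s x)) \<and>
     (\<forall>r\<in>L0 M. \<forall>s\<in>L0 M. \<forall>x\<in>mcarrier E. msmul E (l0_mul M r s) x = msmul E r (msmul E s x)) \<and>
     (\<forall>x\<in>mcarrier E. msmul E (l0c M 1) x = x))"

text \<open>concatenation sum_k 1_{A_k} x_k\<close>
definition m_concat :: "'a measure \<Rightarrow> ('a, 'e) l0mod \<Rightarrow> (nat \<Rightarrow> 'a set) \<Rightarrow> (nat \<Rightarrow> 'e) \<Rightarrow> 'e" where
  "m_concat M E A x = (THE y. y \<in> mcarrier E \<and>
     (\<forall>k. msmul E (l0_ind M (A k)) y = msmul E (l0_ind M (A k)) (x k)))"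

definition stable_module :: "'a measure \<Rightarrow> ('a, 'e) l0mod \<Rightarrow> bool" where
  "stable_module M E = (\<forall>A x. meas_part M A \<and> (\<forall>k. x k \<in> mcarrier E) \<longrightarrow>
     (\<exists>!y. y \<in> mcarrier E \<and> (\<forall>k. msmul E (l0_ind M (A k)) y = msmul E (l0_ind M (A k)) (x k))))"

definition stable_set :: "'a measure \<Rightarrow> ('a, 'e) l0mod \<Rightarrow> 'e set \<Rightarrow> bool" where
  "stable_set M E S = (S \<subseteq> mcarrier E \<and>
     (\<forall>A x. meas_part M A \<and> (\<forall>k. x k \<in> S) \<longrightarrow> m_concat M E A x \<in> S))"

definition set_concat :: "'a measure \<Rightarrow> ('a, 'e) l0mod \<Rightarrow> (nat \<Rightarrow> 'a set) \<Rightarrow> (nat \<Rightarrow> 'e set) \<Rightarrow> 'e set" where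
  "set_concat M E A B = {m_concat M E A y | y. \<forall>k. y k \<in> B k}"

definition stable_coll :: "'a measure \<Rightarrow> ('a, 'e) l0mod \<Rightarrow> 'e set set \<Rightarrow> bool" where
  "stable_coll M E C = (\<forall>A B. meas_part M A \<and> (\<forall>k. B k \<in> C) \<longrightarrow> set_concat M E A B \<in> C)"

definition l0_seminorm :: "'a measure \<Rightarrow> ('a, 'e) l0mod \<Rightarrow> ('e \<Rightarrow> 'a L0) \<Rightarrow> bool" where
  "l0_seminorm M E p = (p \<in> extensional (mcarrier E) \<and>
     (\<forall>x\<in>mcarrier E. p x \<in> L0p M) \<and>
     (\<forall>r\<in>L0 M. \<forall>x\<in>mcarrier E. p (msmul E r x) = l0_mul M (l0_abs M r) (p x)) \<and>
     (\<forall>x\<in>mcarrier E. \<forall>y\<in>mcarrier E. l0_le M (p (madd E x y)) (l0_add M (p x) (p y))))"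

definition smn_concat :: "'a measure \<Rightarrow> ('a, 'e) l0mod \<Rightarrow> (nat \<Rightarrow> 'a set) \<Rightarrow> (nat \<Rightarrow> 'e \<Rightarrow> 'a L0) \<Rightarrow> 'e \<Rightarrow> 'a L0" where
  "smn_concat M E A q = (\<lambda>x\<in>mcarrier E. l0_concat M A (\<lambda>k. q k x))"

definition stable_family :: "'a measure \<Rightarrow> ('a, 'e) l0mod \<Rightarrow> ('e \<Rightarrow> 'a L0) set \<Rightarrow> bool" where
  "stable_family M E P = (\<forall>A q. meas_part M A \<and> (\<forall>k. q k \<in> P) \<longrightarrow> smn_concat M E A q \<in> P)"

definition separated :: "'a measure \<Rightarrow> ('a, 'e) l0mod \<Rightarrow> ('e \<Rightarrow> 'a L0) set \<Rightarrow> bool" where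
  "separated M E P = (\<forall>x\<in>mcarrier E. l0_is_sup M {p x | p. p \<in> P} (l0c M 0) \<longrightarrow> x = mzero E)"

definition st :: "'a measure \<Rightarrow> ('a, 'e) l0mod \<Rightarrow> ('e \<Rightarrow> 'a L0) set \<Rightarrow> ('e \<Rightarrow> 'a L0) set" where
  "st M E N = {smn_concat M E B q | B q. meas_part M B \<and> (\<forall>j. q j \<in> N)}"

definition stable_finite :: "'a measure \<Rightarrow> ('a, 'e) l0mod \<Rightarrow> ('e \<Rightarrow> 'a L0) set \<Rightarrow> ('e \<Rightarrow> 'a L0) set \<Rightarrow> bool" where
  "stable_finite M E P N = (N \<subseteq> P \<and> (\<exists>A Nk. meas_part M A \<and> (\<forall>k. finite (Nk k) \<and> Nk k \<subseteq> P) \<and>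
     N = {smn_concat M E A q | q. \<forall>k. q k \<in> st M E (Nk k)}))"

definition sball :: "'a measure \<Rightarrow> ('a, 'e) l0mod \<Rightarrow> ('e \<Rightarrow> 'a L0) set \<Rightarrow> 'e \<Rightarrow> 'a L0 \<Rightarrow> 'e set" where
  "sball M E N x r = {y \<in> mcarrier E. \<exists>s. l0_is_sup M {p (mdiff M E x y) | p. p \<in> N} s \<and> l0_less M s r}"

definition Ts :: "'a measure \<Rightarrow> ('a, 'e) l0mod \<Rightarrow> ('e \<Rightarrow> 'a L0) set \<Rightarrow> 'e topology" where
  "Ts M E P = topology_generated_by
     {sball M E N x r | N x r. stable_finite M E P N \<and> x \<in> mcarrier E \<and> r \<in> L0pp M}"

definition l0_linear :: "'a measure \<Rightarrow> ('a, 'e) l0mod \<Rightarrow> ('e \<Rightarrow> 'a L0) \<Rightarrow> bool" where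
  "l0_linear M E f = ((\<forall>x\<in>mcarrier E. \<forall>y\<in>mcarrier E. f (madd E x y) = l0_add M (f x) (f y)) \<and>
     (\<forall>r\<in>L0 M. \<forall>x\<in>mcarrier E. f (msmul E r x) = l0_mul M r (f x)))"

definition dual :: "'a measure \<Rightarrow> ('a, 'e) l0mod \<Rightarrow> ('e \<Rightarrow> 'a L0) set \<Rightarrow> ('e \<Rightarrow> 'a L0) set" where
  "dual M E P = {f \<in> extensional (mcarrier E). l0_linear M E f \<and> continuous_map (Ts M E P) (L0top M) f}"

definition dual_mod :: "'a measure \<Rightarrow> ('a, 'e) l0mod \<Rightarrow> ('e \<Rightarrow> 'a L0) set \<Rightarrow> ('a, 'e \<Rightarrow> 'a L0) l0mod" where
  "dual_mod M E P = \<lparr> mcarrier = dual M E P,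
      madd = (\<lambda>f g. \<lambda>x\<in>mcarrier E. l0_add M (f x) (g x)),
      mzero = (\<lambda>x\<in>mcarrier E. l0c M 0),
      msmul = (\<lambda>r f. \<lambda>x\<in>mcarrier E. l0_mul M r (f x)) \<rparr>"

definition weak_fam :: "'a measure \<Rightarrow> ('a, 'e) l0mod \<Rightarrow> ('e \<Rightarrow> 'a L0) set \<Rightarrow> (('e \<Rightarrow> 'a L0) \<Rightarrow> 'a L0) set" where
  "weak_fam M E P = {(\<lambda>f\<in>dual M E P. l0_abs M (f x)) | x. x \<in> mcarrier E}"

definition sigma_s :: "'a measure \<Rightarrow> ('a, 'e) l0mod \<Rightarrow> ('e \<Rightarrow> 'a L0) set \<Rightarrow> ('e \<Rightarrow> 'a L0) topology" where
  "sigma_s M E P = Ts M (dual_mod M E P) (weak_fam M E P)"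

definition polar :: "'a measure \<Rightarrow> ('a, 'e) l0mod \<Rightarrow> ('e \<Rightarrow> 'a L0) set \<Rightarrow> 'e set \<Rightarrow> ('e \<Rightarrow> 'a L0) set" where
  "polar M E P U = {f \<in> dual M E P. \<forall>x\<in>U. l0_le M (f x) (l0c M 1)}"

definition filter_on :: "'x set \<Rightarrow> 'x set set \<Rightarrow> bool" where
  "filter_on X F = (F \<subseteq> Pow X \<and> X \<in> F \<and> {} \<notin> F \<and>
     (\<forall>V\<in>F. \<forall>W\<in>F. V \<inter> W \<in> F) \<and> (\<forall>V\<in>F. \<forall>W. V \<subseteq> W \<and> W \<subseteq> X \<longrightarrow> W \<in> F))"

definition stable_filter :: "'a measure \<Rightarrow> ('a, 'e) l0mod \<Rightarrow> 'e set \<Rightarrow> 'e set set \<Rightarrow> bool" where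
  "stable_filter M E X F = (filter_on X F \<and>
     (\<exists>B. B \<subseteq> F \<and> (\<forall>V\<in>F. \<exists>b\<in>B. b \<subseteq> V) \<and> (\<forall>b\<in>B. stable_set M E b) \<and> stable_coll M E B))"

definition cluster_point :: "'x topology \<Rightarrow> 'x set set \<Rightarrow> 'x \<Rightarrow> bool" where
  "cluster_point T F x = (\<forall>V\<in>F. x \<in> T closure_of V)"

definition stable_compact :: "'a measure \<Rightarrow> ('a, 'e) l0mod \<Rightarrow> 'e topology \<Rightarrow> 'e set \<Rightarrow> bool" where
  "stable_compact M E T K = (stable_set M E K \<and>
     (\<forall>F. stable_filter M E K F \<longrightarrow> (\<exists>x\<in>K. cluster_point T F x)))"

definition neighbourhood :: "'x topology \<Rightarrow> 'x \<Rightarrow> 'x set \<Rightarrow> bool" where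
  "neighbourhood T x U = (U \<subseteq> topspace T \<and> (\<exists>W. openin T W \<and> x \<in> W \<and> W \<subseteq> U))"

end

theory Submission
  imports Defs
begin

text \<open>
  A linear \<open>L\<^sup>0\<close>-valued functional that is at most \<open>1\<close> on a neighbourhood of \<open>0\<close> is continuous, so the
  polar is the set of all linear functionals that are at most \<open>1\<close> on \<open>U\<close>. It is closed under
  concatenations, and since \<open>U\<close> is absorbing, it is pointwise bounded in \<open>L\<^sup>0\<close>.

  By Zorn's lemma, the base of a stable filter on the polar is contained in a maximal stable base \<open>H\<close>; a
  stable set meeting every member of a maximal base belongs to it. For fixed \<open>x\<close> let
  \<open>l x = ess sup\<^bsub>b \<in> H\<^esub> ess inf\<^bsub>f \<in> b\<^esub> f x\<close>. Countable concatenations show that, for every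
  \<open>\<epsilon> > 0\<close> in \<open>L\<^sup>0\<close>, some member of \<open>H\<close> lies in \<open>{f. f x \<ge> l x - \<epsilon>}\<close> and every member meets
  \<open>{f. f x \<le> l x + \<epsilon>}\<close>; hence \<open>H\<close> converges pointwise to \<open>l\<close>. The limit is again linear and at most
  \<open>1\<close> on \<open>U\<close>. As \<open>H\<close> is closed under concatenations, the convergence is uniform on stable finite sets of
  points, so \<open>l\<close> is a cluster point of the filter.
\<close>

section \<open>Essential suprema and measurable partitions\<close>

text \<open>Ordinary ultrafilters do not fit here: the complement of a stable set is in general not
  stable, so a maximal stable base cannot be expected to contain a given set or its complement. What
  survives is the weaker property of containing every stable set that meets all members, and the
  construction of \<open>l\<close> is arranged so that this suffices. The order of \<open>L0\<close>
  being partial, an element may lie above \<open>l\<close> on one part of the space and below it on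
  another; concatenation along a measurable partition replaces the case distinction available for
  real numbers. Partitions are countable, which is why every essential supremum and infimum is first
  reduced to a sequence. Tolerances are a.e. positive random variables instead of numbers. The same
  device meets the last obstacle, that a stable finite family usually has uncountably many members:
  on each piece of its partition only finitely many seminorms occur.\<close>

lemma (in prob_space) countable_ess_sup_bounded:
  fixes S :: "('a \<Rightarrow> real) set"
  assumes "S \<noteq> {}" and meas: "\<And>g. g \<in> S \<Longrightarrow> g \<in> borel_measurable M"
    and bd: "\<And>g \<omega>. g \<in> S \<Longrightarrow> \<bar>g \<omega>\<bar> \<le> C"
  shows "\<exists>g :: nat \<Rightarrow> 'a \<Rightarrow> real. range g \<subseteq> S \<and> (\<forall>h\<in>S. AE \<omega> in M. h \<omega> \<le> (SUP n. g n \<omega>))"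
proof -
  define Q where "Q = {g :: nat \<Rightarrow> 'a \<Rightarrow> real. range g \<subseteq> S}"
  \<comment> \<open>The essential supremum is found by maximising this integral over all sequences
    in \<open>S\<close>: for an optimal sequence, adjoining a further \<open>h\<close> can raise the
    pointwise supremum only on a null set.\<close>
  define F where "F g = (\<integral>\<omega>. (SUP n. g n \<omega>) \<partial>M)" for g :: "nat \<Rightarrow> 'a \<Rightarrow> real"
  have bdd: "bdd_above (range (\<lambda>n. g n \<omega>))" if "g \<in> Q" for g \<omega>
    using bd that unfolding Q_def by (intro bdd_aboveI2[where M=C]) (smt (verit) mem_Collect_eq range_subsetD)
  have upper: "g n \<omega> \<le> (SUP n. g n \<omega>)" if "g \<in> Q" for g n \<omega>
    using bdd[OF that] by (intro cSUP_upper) auto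
  have abs_sup: "\<bar>SUP n. g n \<omega>\<bar> \<le> C" if "g \<in> Q" for g \<omega>
  proof -
    have "\<bar>g n \<omega>\<bar> \<le> C" for n using bd that unfolding Q_def by blast
    then have "(SUP n. g n \<omega>) \<le> C" "- C \<le> g 0 \<omega>"
      by (auto intro!: cSUP_least simp: abs_le_iff minus_le_iff)
    then show ?thesis using upper[OF that, of 0 \<omega>] by linarith
  qed
  have meas_sup: "(\<lambda>\<omega>. SUP n. g n \<omega>) \<in> borel_measurable M" if "g \<in> Q" for g
    using that meas bdd[OF that] unfolding Q_def by (intro borel_measurable_cSUP) auto
  have int: "integrable M (\<lambda>\<omega>. SUP n. g n \<omega>)" if "g \<in> Q" for g
    using meas_sup[OF that] abs_sup[OF that] by (intro integrable_const_bound[where B=C]) auto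
  have F_mono: "F g \<le> F g'" if gg: "g \<in> Q" "g' \<in> Q" "range g \<subseteq> range g'" for g g'
    unfolding F_def
  proof (intro integral_mono int gg cSUP_least)
    fix \<omega> n
    obtain m where "g n = g' m" using gg(3) by blast
    then show "g n \<omega> \<le> (SUP n. g' n \<omega>)" using upper[OF gg(2)] by auto
  qed simp
  have F_bd: "F g \<le> C" if "g \<in> Q" for g
  proof -
    have "F g \<le> (\<integral>\<omega>. C \<partial>M)" unfolding F_def
      using abs_sup[OF that] by (intro integral_mono int that) (auto simp: abs_le_iff)
    then show ?thesis by (simp add: prob_space)
  qed
  have bddF: "bdd_above (F ` Q)" using F_bd by (intro bdd_aboveI2[where M=C])
  obtain h0 where "h0 \<in> S" using assms(1) by blast
  then have "Q \<noteq> {}" unfolding Q_def by (auto intro!: exI[of _ "\<lambda>_. h0"])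
  define \<alpha> where "\<alpha> = (SUP g\<in>Q. F g)"
  have "\<exists>g\<in>Q. \<alpha> - 1 / real (Suc j) < F g" for j
    using less_cSUP_iff[OF \<open>Q \<noteq> {}\<close> bddF, of "\<alpha> - 1 / real (Suc j)"] unfolding \<alpha>_def by simp
  then obtain G where G: "\<And>j. G j \<in> Q" "\<And>j. \<alpha> - 1 / real (Suc j) < F (G j)" by metis
  \<comment> \<open>One sequence listing all terms of all near-optimal sequences; its integral
    dominates every \<open>F (G j)\<close> and therefore attains \<open>\<alpha>\<close>.\<close>
  define g where "g n = G (fst (prod_decode n)) (snd (prod_decode n))" for n
  have gQ: "g \<in> Q" using G(1) unfolding Q_def g_def by blast
  have "G j n = g (prod_encode (j, n))" for j n by (simp add: g_def)
  then have sub: "range (G j) \<subseteq> range g" for j by auto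
  have "\<alpha> - 1 / real (Suc j) < F g" for j
    using F_mono[OF G(1) gQ sub, of j] G(2)[of j] by linarith
  then have near: "\<alpha> < F g + 1 / real (Suc j)" for j by (simp add: algebra_simps)
  have \<alpha>_le: "\<alpha> \<le> F g"
  proof (rule field_le_epsilon)
    fix e :: real assume "e > 0"
    then obtain j where "1 / real (Suc j) < e" by (rule nat_approx_posE)
    then show "\<alpha> \<le> F g + e" using near[of j] by linarith
  qed
  have "AE \<omega> in M. h \<omega> \<le> (SUP n. g n \<omega>)" if "h \<in> S" for h
  proof -
    \<comment> \<open>Prepending \<open>h\<close> can only enlarge the supremum pointwise, while
      optimality keeps the integral the same; so the two suprema agree almost everywhere.\<close>
    define g' where "g' = case_nat h g"
    have "g' \<in> Q" using gQ that unfolding Q_def g'_def by (auto split: nat.splits dest: range_subsetD)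
    have sub: "range g \<subseteq> range g'" unfolding g'_def by (metis image_subset_iff nat.case(2) rangeI)
    have le: "(SUP n. g n \<omega>) \<le> (SUP n. g' n \<omega>)" for \<omega>
    proof (intro cSUP_least)
      fix n show "g n \<omega> \<le> (SUP n. g' n \<omega>)"
        using upper[OF \<open>g' \<in> Q\<close>, of "Suc n" \<omega>] by (simp add: g'_def)
    qed simp
    have "F g' \<le> \<alpha>" unfolding \<alpha>_def using \<open>g' \<in> Q\<close> bddF by (intro cSUP_upper) auto
    then have "F g' = F g" using F_mono[OF gQ \<open>g' \<in> Q\<close> sub] \<alpha>_le by linarith
    then have "(\<integral>\<omega>. (SUP n. g' n \<omega>) - (SUP n. g n \<omega>) \<partial>M) = 0"
      using int gQ \<open>g' \<in> Q\<close> by (simp add: F_def)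
    then have "AE \<omega> in M. (SUP n. g' n \<omega>) - (SUP n. g n \<omega>) = 0"
      using int gQ \<open>g' \<in> Q\<close> le by (subst (asm) integral_nonneg_eq_0_iff_AE) auto
    then show ?thesis
    proof eventually_elim
      case (elim \<omega>)
      then show ?case using upper[OF \<open>g' \<in> Q\<close>, of 0 \<omega>] by (simp add: g'_def)
    qed
  qed
  then show ?thesis using gQ unfolding Q_def by blast
qed

text \<open>Composition with the increasing function \<open>arctan\<close> reduces to the bounded
  case. The last conclusion is put in \<open>e\<close>-form because it is what later provides, at
  almost every point, a nearly optimal index to select.\<close>

lemma (in prob_space) countable_ess_sup:
  fixes S :: "('a \<Rightarrow> real) set"
  assumes "S \<noteq> {}" and meas: "\<And>g. g \<in> S \<Longrightarrow> g \<in> borel_measurable M"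
    and c: "c \<in> borel_measurable M" "\<And>g. g \<in> S \<Longrightarrow> AE \<omega> in M. g \<omega> \<le> c \<omega>"
  obtains g :: "nat \<Rightarrow> 'a \<Rightarrow> real" and s where "range g \<subseteq> S" "s \<in> borel_measurable M"
    "\<And>h. h \<in> S \<Longrightarrow> AE \<omega> in M. h \<omega> \<le> s \<omega>"
    "AE \<omega> in M. \<forall>e>0. \<exists>n. s \<omega> - e < g n \<omega>"
proof -
  have "\<exists>g :: nat \<Rightarrow> 'a \<Rightarrow> real. range g \<subseteq> (\<lambda>g \<omega>. arctan (g \<omega>)) ` S \<and>
      (\<forall>h\<in>(\<lambda>g \<omega>. arctan (g \<omega>)) ` S. AE \<omega> in M. h \<omega> \<le> (SUP n. g n \<omega>))"
  proof (rule countable_ess_sup_bounded[where C=pi])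
    fix g \<omega> assume "g \<in> (\<lambda>g \<omega>. arctan (g \<omega>)) ` S"
    then obtain h where "g = (\<lambda>\<omega>. arctan (h \<omega>))" by blast
    then show "\<bar>g \<omega>\<bar> \<le> pi" using arctan_bounded[of "h \<omega>"] pi_gt_zero by auto
  qed (use assms in \<open>auto simp: image_iff\<close>)
  then obtain g' :: "nat \<Rightarrow> 'a \<Rightarrow> real" where g': "range g' \<subseteq> (\<lambda>g \<omega>. arctan (g \<omega>)) ` S"
    "\<And>h. h \<in> S \<Longrightarrow> AE \<omega> in M. arctan (h \<omega>) \<le> (SUP n. g' n \<omega>)" by auto
  then have "\<exists>g\<in>S. g' n = (\<lambda>\<omega>. arctan (g \<omega>))" for n by blast
  then obtain g where g: "\<And>n. g n \<in> S" "\<And>n. g' n = (\<lambda>\<omega>. arctan (g n \<omega>))" by metis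
  define s where "s \<omega> = (SUP n. min (g n \<omega>) (c \<omega>))" for \<omega>
  have bdd: "bdd_above (range (\<lambda>n. min (g n \<omega>) (c \<omega>)))" for \<omega>
    by (intro bdd_aboveI2[where M="c \<omega>"]) simp
  have s: "s \<in> borel_measurable M"
    unfolding s_def using g meas c(1) bdd by (intro borel_measurable_cSUP borel_measurable_min) auto
  have gc: "AE \<omega> in M. \<forall>n. g n \<omega> \<le> c \<omega>" using c(2) g(1) by (simp add: AE_all_countable)
  have "AE \<omega> in M. h \<omega> \<le> s \<omega>" if "h \<in> S" for h
    using g'(2)[OF that] gc
  proof eventually_elim
    case (elim \<omega>)
    have "g n \<omega> \<le> s \<omega>" for n
      using cSUP_upper[OF UNIV_I bdd, of n \<omega>] elim(2) by (simp add: s_def min_def)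
    then have "(SUP n. g' n \<omega>) \<le> arctan (s \<omega>)"
      by (intro cSUP_least) (auto simp: g arctan_le_iff)
    then show ?case using elim(1) by (meson arctan_le_iff order_trans)
  qed
  moreover have "AE \<omega> in M. \<forall>e>0. \<exists>n. s \<omega> - e < g n \<omega>"
    using gc
  proof eventually_elim
    case (elim \<omega>)
    have "\<exists>n. s \<omega> - e < min (g n \<omega>) (c \<omega>)" if "e > 0" for e
      using less_cSUP_iff[OF _ bdd, of "s \<omega> - e" \<omega>] that unfolding s_def by simp
    then show ?case by fastforce
  qed
  ultimately show ?thesis using that s g(1) by blast
qed

lemma (in prob_space) countable_ess_inf:
  fixes S :: "('a \<Rightarrow> real) set"
  assumes "S \<noteq> {}" and meas: "\<And>g. g \<in> S \<Longrightarrow> g \<in> borel_measurable M"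
    and c: "c \<in> borel_measurable M" "\<And>g. g \<in> S \<Longrightarrow> AE \<omega> in M. c \<omega> \<le> g \<omega>"
  obtains g :: "nat \<Rightarrow> 'a \<Rightarrow> real" and s where "range g \<subseteq> S" "s \<in> borel_measurable M"
    "\<And>h. h \<in> S \<Longrightarrow> AE \<omega> in M. s \<omega> \<le> h \<omega>"
    "AE \<omega> in M. \<forall>e>0. \<exists>n. g n \<omega> < s \<omega> + e"
proof -
  define S' where "S' = (\<lambda>g \<omega>. - g \<omega>) ` S"
  obtain g :: "nat \<Rightarrow> 'a \<Rightarrow> real" and s where g: "range g \<subseteq> S'" "s \<in> borel_measurable M"
    "\<And>h. h \<in> S' \<Longrightarrow> AE \<omega> in M. h \<omega> \<le> s \<omega>"
    "AE \<omega> in M. \<forall>e>0. \<exists>n. s \<omega> - e < g n \<omega>"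
    by (rule countable_ess_sup[of S' "\<lambda>\<omega>. - c \<omega>"]) (use assms in \<open>auto simp: S'_def\<close>)
  show ?thesis
  proof (rule that[of "\<lambda>n \<omega>. - g n \<omega>" "\<lambda>\<omega>. - s \<omega>"])
    show "range (\<lambda>n \<omega>. - g n \<omega>) \<subseteq> S" using g(1) by (fastforce simp: S'_def image_iff)
    show "AE \<omega> in M. - s \<omega> \<le> h \<omega>" if "h \<in> S" for h
      using g(3)[of "\<lambda>\<omega>. - h \<omega>"] that by (auto simp: S'_def elim!: eventually_mono)
    show "AE \<omega> in M. \<forall>e>0. \<exists>n. - g n \<omega> < - s \<omega> + e"
      using g(4) by eventually_elim (simp add: algebra_simps)
  qed (use g in auto)
qed

section \<open>Measurable selection and refinement of partitions\<close>

lemma measurable_selection_partition: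
  assumes meas: "\<And>n :: nat. {\<omega> \<in> space M. P n \<omega>} \<in> sets M" and ex: "AE \<omega> in M. \<exists>n. P n \<omega>"
  obtains A where "meas_part M A" "\<And>n. AE \<omega> in M. \<omega> \<in> A n \<longrightarrow> P n \<omega>"
proof -
  define D where "D = disjointed (\<lambda>n. {\<omega> \<in> space M. P n \<omega>})"
  \<comment> \<open>\<open>D\<close> assigns to each point its first admissible index. The points
    without one form a null set and are put into piece 0, so that \<open>A\<close> covers all of
    \<open>space M\<close>.\<close>
  define A where "A n = (if n = 0 then D 0 \<union> (space M - (\<Union>n. D n)) else D n)" for n
  have UD: "(\<Union>n. D n) = (\<Union>n. {\<omega> \<in> space M. P n \<omega>})" by (simp add: D_def UN_disjointed_eq)
  have DP: "D n \<subseteq> {\<omega> \<in> space M. P n \<omega>}" for n unfolding D_def by (rule disjointed_subset)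
  have Ds: "D n \<in> sets M" for n
    using sets.range_disjointed_sets[of "\<lambda>n. {\<omega> \<in> space M. P n \<omega>}" M] meas unfolding D_def by blast
  have disj: "disjoint_family D" unfolding D_def by (rule disjoint_family_disjointed)
  have "meas_part M A" unfolding meas_part_def
  proof (intro conjI allI)
    show "A k \<in> sets M" for k using Ds by (auto simp: A_def)
    show "disjoint_family A" 
      unfolding disjoint_family_on_def
    proof (intro ballI impI)
      fix m n :: nat assume "m \<noteq> n"
      then have "D m \<inter> D n = {}" using disj by (simp add: disjoint_family_on_def)
      then show "A m \<inter> A n = {}" using \<open>m \<noteq> n\<close> by (cases "m = 0"; cases "n = 0") (auto simp: A_def)
    qed
    show "(\<Union>k. A k) = space M"
    proof
      show "(\<Union>k. A k) \<subseteq> space M" using DP by (auto simp: A_def split: if_splits)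
      show "space M \<subseteq> (\<Union>k. A k)"
      proof
        fix \<omega> assume "\<omega> \<in> space M"
        show "\<omega> \<in> (\<Union>k. A k)"
        proof (cases "\<omega> \<in> (\<Union>n. D n)")
          case True
          then obtain n where "\<omega> \<in> D n" by blast
          then have "\<omega> \<in> A n" by (auto simp: A_def)
          then show ?thesis by blast
        next
          case False
          then have "\<omega> \<in> A 0" using \<open>\<omega> \<in> space M\<close> by (auto simp: A_def)
          then show ?thesis by blast
        qed
      qed
    qed
  qed
  moreover have "AE \<omega> in M. \<omega> \<in> A n \<longrightarrow> P n \<omega>" for n
    using ex AE_space
  proof eventually_elim
    case (elim \<omega>)
    then have "\<omega> \<in> (\<Union>n. D n)" unfolding UD by blast
    then have "\<omega> \<in> A n \<Longrightarrow> \<omega> \<in> D n" by (auto simp: A_def split: if_splits)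
    then show ?case using DP by blast
  qed
  ultimately show ?thesis using that by blast
qed

text \<open>Each piece \<open>A k\<close> is refined by a partition \<open>A' k\<close> of its own,
  pairs being coded by \<open>prod_decode\<close>; this turns an iterated concatenation into a
  single countable one.\<close>

lemma meas_part_prod:
  assumes A: "meas_part M A" and A': "\<And>k. meas_part M (A' k)"
  shows "meas_part M (\<lambda>n. A (fst (prod_decode n)) \<inter> A' (fst (prod_decode n)) (snd (prod_decode n)))"
  unfolding meas_part_def
proof (intro conjI allI)
  show "A (fst (prod_decode n)) \<inter> A' (fst (prod_decode n)) (snd (prod_decode n)) \<in> sets M" for n
    using assms by (auto simp: meas_part_def)
  show "disjoint_family (\<lambda>n. A (fst (prod_decode n)) \<inter> A' (fst (prod_decode n)) (snd (prod_decode n)))"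
    unfolding disjoint_family_on_def
  proof (intro ballI impI)
    fix m n :: nat assume "m \<noteq> n"
    then have "prod_decode m \<noteq> prod_decode n" by (metis prod_decode_inverse)
    then show "A (fst (prod_decode m)) \<inter> A' (fst (prod_decode m)) (snd (prod_decode m)) \<inter>
        (A (fst (prod_decode n)) \<inter> A' (fst (prod_decode n)) (snd (prod_decode n))) = {}"
      using assms unfolding meas_part_def disjoint_family_on_def prod_eq_iff
      by (cases "fst (prod_decode m) = fst (prod_decode n)") (simp, blast)+
  qed
  show "(\<Union>n. A (fst (prod_decode n)) \<inter> A' (fst (prod_decode n)) (snd (prod_decode n))) = space M"
  proof
    show "(\<Union>n. A (fst (prod_decode n)) \<inter> A' (fst (prod_decode n)) (snd (prod_decode n))) \<subseteq> space M"
      using A unfolding meas_part_def by blast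
    show "space M \<subseteq> (\<Union>n. A (fst (prod_decode n)) \<inter> A' (fst (prod_decode n)) (snd (prod_decode n)))"
    proof
      fix \<omega> assume "\<omega> \<in> space M"
      then obtain k j where "\<omega> \<in> A k" "\<omega> \<in> A' k j" using assms unfolding meas_part_def by blast
      then show "\<omega> \<in> (\<Union>n. A (fst (prod_decode n)) \<inter> A' (fst (prod_decode n)) (snd (prod_decode n)))"
        by (intro UN_I[of "prod_encode (k, j)"]) auto
    qed
  qed
qed

lemma meas_part_AE:
  assumes "meas_part M A" and "\<And>k. AE \<omega> in M. \<omega> \<in> A k \<longrightarrow> Q \<omega>"
  shows "AE \<omega> in M. Q \<omega>"
proof -
  have "AE \<omega> in M. \<forall>k. \<omega> \<in> A k \<longrightarrow> Q \<omega>" using assms(2) by (simp only: AE_all_countable) simp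
  then show ?thesis using AE_space
  proof eventually_elim
    case (elim \<omega>)
    then show ?case using assms(1) unfolding meas_part_def by blast
  qed
qed

text \<open>A two-piece partition padded with empty sets. It expresses changing an element off
  \<open>A\<close> as a concatenation, and gives the trivial partition for
  \<open>A = space M\<close>.\<close>

lemma meas_part_split:
  assumes "A \<in> sets M"
  shows "meas_part M (\<lambda>n. if n = 0 then A else if n = 1 then space M - A else {})"
  using assms sets.sets_into_space[OF assms]
  by (auto simp: meas_part_def disjoint_family_on_def split: if_splits)

section \<open>Maximal stable bases\<close>

text \<open>Isolates what the compactness argument sees of the polar: elements are known through the
  functions \<open>ev f x\<close>, up to null sets, and can be glued along partitions. The bound in
  \<open>ev_bounded\<close> is uniform over \<open>K\<close> but may depend on \<open>x\<close> and
  on the point of the space; it keeps the limits finite.\<close>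

locale concat_space = prob_space M for M :: "'a measure" +
  fixes K :: "'k set" and X :: "'x set" and ev :: "'k \<Rightarrow> 'x \<Rightarrow> 'a \<Rightarrow> real"
    and cc :: "(nat \<Rightarrow> 'a set) \<Rightarrow> (nat \<Rightarrow> 'k) \<Rightarrow> 'k"
  assumes ev_measurable: "\<And>f x. f \<in> K \<Longrightarrow> x \<in> X \<Longrightarrow> ev f x \<in> borel_measurable M"
    and cc_closed: "\<And>A f. meas_part M A \<Longrightarrow> (\<And>k. f k \<in> K) \<Longrightarrow> cc A f \<in> K"
    and ev_cc: "\<And>A f x k. meas_part M A \<Longrightarrow> (\<And>k. f k \<in> K) \<Longrightarrow> x \<in> X \<Longrightarrow>
      AE \<omega> in M. \<omega> \<in> A k \<longrightarrow> ev (cc A f) x \<omega> = ev (f k) x \<omega>"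
    and ev_eqI: "\<And>f g. f \<in> K \<Longrightarrow> g \<in> K \<Longrightarrow> (\<And>x. x \<in> X \<Longrightarrow> AE \<omega> in M. ev f x \<omega> = ev g x \<omega>) \<Longrightarrow> f = g"
    and ev_bounded: "\<And>x. x \<in> X \<Longrightarrow> \<exists>c\<in>borel_measurable M. \<forall>f\<in>K. AE \<omega> in M. \<bar>ev f x \<omega>\<bar> \<le> c \<omega>"
begin

lemma cc_eqI:
  assumes A: "meas_part M A" and f: "\<And>k. f k \<in> K" and g: "g \<in> K"
    and eq: "\<And>x k. x \<in> X \<Longrightarrow> AE \<omega> in M. \<omega> \<in> A k \<longrightarrow> ev g x \<omega> = ev (f k) x \<omega>"
  shows "cc A f = g"
proof (rule ev_eqI[OF cc_closed[OF A f] g])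
  fix x assume x: "x \<in> X"
  show "AE \<omega> in M. ev (cc A f) x \<omega> = ev g x \<omega>"
  proof (rule meas_part_AE[OF A])
    fix k show "AE \<omega> in M. \<omega> \<in> A k \<longrightarrow> ev (cc A f) x \<omega> = ev g x \<omega>"
      using ev_cc[OF A f x, of k] eq[OF x, of k] by eventually_elim auto
  qed
qed

section \<open>Stable sets and their concatenations\<close>

definition stab :: "'k set \<Rightarrow> bool" where
  "stab b \<longleftrightarrow> b \<subseteq> K \<and> (\<forall>A f. meas_part M A \<and> (\<forall>k. f k \<in> b) \<longrightarrow> cc A f \<in> b)"

definition sc :: "(nat \<Rightarrow> 'a set) \<Rightarrow> (nat \<Rightarrow> 'k set) \<Rightarrow> 'k set" where
  "sc A b = {cc A f | f. \<forall>k. f k \<in> b k}"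

text \<open>The last clause is stability of the collection. Upward closure is not imposed, since a
  superset of a stable set need not be stable.\<close>

definition stab_base :: "'k set set \<Rightarrow> bool" where
  "stab_base H \<longleftrightarrow> (\<forall>b\<in>H. stab b \<and> b \<noteq> {}) \<and> (\<forall>b\<in>H. \<forall>c\<in>H. \<exists>d\<in>H. d \<subseteq> b \<inter> c) \<and>
     (\<forall>A b. meas_part M A \<and> (\<forall>k. b k \<in> H) \<longrightarrow> sc A b \<in> H)"

lemma sc_I: "(\<And>k. f k \<in> b k) \<Longrightarrow> cc A f \<in> sc A b"
  unfolding sc_def by blast

lemma stab_subset: "stab b \<Longrightarrow> b \<subseteq> K"
  by (simp add: stab_def)

lemma stab_cc: "stab b \<Longrightarrow> meas_part M A \<Longrightarrow> (\<And>k. f k \<in> b) \<Longrightarrow> cc A f \<in> b"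
  by (simp add: stab_def)

lemma stab_Int: "stab b \<Longrightarrow> stab c \<Longrightarrow> stab (b \<inter> c)"
  by (auto simp: stab_def)

text \<open>Both sides equal \<open>f j k\<close> on \<open>A k \<inter> A' j\<close>, and these
  sets cover the space.\<close>

lemma cc_swap:
  assumes A: "meas_part M A" and A': "meas_part M A'" and f: "\<And>j k. f j k \<in> K"
  shows "cc A' (\<lambda>j. cc A (f j)) = cc A (\<lambda>k. cc A' (\<lambda>j. f j k))"
proof (rule cc_eqI[OF A' cc_closed[OF A f] cc_closed[OF A cc_closed[OF A' f]]])
  fix x j assume x: "x \<in> X"
  show "AE \<omega> in M. \<omega> \<in> A' j \<longrightarrow> ev (cc A (\<lambda>k. cc A' (\<lambda>j. f j k))) x \<omega> = ev (cc A (f j)) x \<omega>"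
  proof (rule meas_part_AE[OF A])
    fix k
    show "AE \<omega> in M. \<omega> \<in> A k \<longrightarrow> \<omega> \<in> A' j \<longrightarrow> ev (cc A (\<lambda>k. cc A' (\<lambda>j. f j k))) x \<omega> = ev (cc A (f j)) x \<omega>"
      using ev_cc[of A "\<lambda>k. cc A' (\<lambda>j. f j k)" x k, OF A cc_closed[OF A' f] x]
        ev_cc[of A "f j" x k, OF A f x] ev_cc[of A' "\<lambda>j. f j k" x j, OF A' f x] by eventually_elim auto
  qed
qed

lemma cc_prod:
  assumes A: "meas_part M A" and A': "\<And>k. meas_part M (A' k)" and f: "\<And>n. f n \<in> K"
  shows "cc (\<lambda>n. A (fst (prod_decode n)) \<inter> A' (fst (prod_decode n)) (snd (prod_decode n))) f
    = cc A (\<lambda>k. cc (A' k) (\<lambda>j. f (prod_encode (k, j))))"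
proof (rule cc_eqI[OF meas_part_prod[OF A A'] f cc_closed[OF A cc_closed[OF A' f]]])
  fix x n assume x: "x \<in> X"
  obtain k j where n: "n = prod_encode (k, j)" by (metis prod_decode_inverse surj_pair)
  show "AE \<omega> in M. \<omega> \<in> A (fst (prod_decode n)) \<inter> A' (fst (prod_decode n)) (snd (prod_decode n)) \<longrightarrow>
      ev (cc A (\<lambda>k. cc (A' k) (\<lambda>j. f (prod_encode (k, j))))) x \<omega> = ev (f n) x \<omega>"
    using ev_cc[of A "\<lambda>k. cc (A' k) (\<lambda>j. f (prod_encode (k, j)))" x k, OF A cc_closed[OF A' f] x]
      ev_cc[of "A' k" "\<lambda>j. f (prod_encode (k, j))" x j, OF A' f x]
    by eventually_elim (auto simp: n)
qed

text \<open>Swapping the two concatenations collects, for fixed \<open>k\<close>, the elements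
  coming from \<open>b k\<close>; stability of \<open>b k\<close> absorbs them.\<close>

lemma stab_sc:
  assumes A: "meas_part M A" and b: "\<And>k. stab (b k)"
  shows "stab (sc A b)"
  unfolding stab_def
proof (intro conjI allI impI)
  have bK: "f \<in> b k \<Longrightarrow> f \<in> K" for f k using stab_subset[OF b] by blast
  show "sc A b \<subseteq> K" unfolding sc_def using cc_closed[OF A] bK by blast
  fix A' and f :: "nat \<Rightarrow> 'k" assume "meas_part M A' \<and> (\<forall>j. f j \<in> sc A b)"
  then have A': "meas_part M A'" and f: "\<forall>j. \<exists>g. f j = cc A g \<and> (\<forall>k. g k \<in> b k)"
    by (auto simp: sc_def)
  then obtain g where g: "\<And>j. f j = cc A (g j)" "\<And>j k. g j k \<in> b k" by metis
  have "cc A' f = cc A (\<lambda>k. cc A' (\<lambda>j. g j k))"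
    using cc_swap[OF A A', of g] g bK by (metis (no_types, lifting) ext)
  moreover have "cc A' (\<lambda>j. g j k) \<in> b k" for k using stab_cc[OF b A', of "\<lambda>j. g j k"] g(2) by blast
  ultimately show "cc A' f \<in> sc A b" using sc_I[of "\<lambda>k. cc A' (\<lambda>j. g j k)"] by simp
qed

lemma sc_const: "stab b \<Longrightarrow> meas_part M A \<Longrightarrow> sc A (\<lambda>_. b) = b"
proof
  assume b: "stab b" and A: "meas_part M A"
  show "sc A (\<lambda>_. b) \<subseteq> b" using b A by (auto simp: sc_def stab_def)
  show "b \<subseteq> sc A (\<lambda>_. b)"
  proof
    fix f assume f: "f \<in> b"
    then have "cc A (\<lambda>_. f) = f" using stab_subset[OF b] A by (intro cc_eqI) auto
    then show "f \<in> sc A (\<lambda>_. b)" unfolding sc_def using f by (intro CollectI exI[of _ "\<lambda>_. f"]) auto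
  qed
qed

lemma sc_prod:
  assumes A: "meas_part M A" and A': "\<And>k. meas_part M (A' k)" and b: "\<And>n. b n \<subseteq> K"
  shows "sc (\<lambda>n. A (fst (prod_decode n)) \<inter> A' (fst (prod_decode n)) (snd (prod_decode n))) b
    = sc A (\<lambda>k. sc (A' k) (\<lambda>j. b (prod_encode (k, j))))" (is "?L = ?R")
proof
  show "?L \<subseteq> ?R"
  proof
    fix h assume "h \<in> ?L"
    then obtain f where f: "\<And>n. f n \<in> b n"
      "h = cc (\<lambda>n. A (fst (prod_decode n)) \<inter> A' (fst (prod_decode n)) (snd (prod_decode n))) f"
      by (auto simp: sc_def)
    have "f n \<in> K" for n using f(1) b by blast
    then have "h = cc A (\<lambda>k. cc (A' k) (\<lambda>j. f (prod_encode (k, j))))"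
      unfolding f(2) by (intro cc_prod A A')
    then show "h \<in> ?R" using f(1) by (simp add: sc_I)
  qed
  show "?R \<subseteq> ?L"
  proof
    fix h assume "h \<in> ?R"
    then obtain f where f: "\<And>k. f k \<in> sc (A' k) (\<lambda>j. b (prod_encode (k, j)))" "h = cc A f"
      by (auto simp: sc_def)
    have "\<forall>k. \<exists>g. f k = cc (A' k) g \<and> (\<forall>j. g j \<in> b (prod_encode (k, j)))"
      using f(1) by (auto simp: sc_def)
    then obtain g where g: "\<And>k. f k = cc (A' k) (g k)" "\<And>k j. g k j \<in> b (prod_encode (k, j))" by metis
    define f' where "f' n = g (fst (prod_decode n)) (snd (prod_decode n))" for n
    have f': "f' n \<in> b n" for n
      using g(2)[of "fst (prod_decode n)" "snd (prod_decode n)"] by (simp add: f'_def)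
    have "f = (\<lambda>k. cc (A' k) (\<lambda>j. f' (prod_encode (k, j))))"
      using g(1) by (simp add: f'_def fun_eq_iff)
    moreover have "f' n \<in> K" for n using f' b by blast
    ultimately have "h = cc (\<lambda>n. A (fst (prod_decode n)) \<inter> A' (fst (prod_decode n)) (snd (prod_decode n))) f'"
      using cc_prod[of A A' f', OF A A'] f(2) by simp
    then show "h \<in> ?L" using f' by (simp add: sc_I)
  qed
qed

lemma sc_mono: "(\<And>k. b k \<subseteq> c k) \<Longrightarrow> sc A b \<subseteq> sc A c"
  unfolding sc_def by blast

lemma stab_baseD:
  assumes "stab_base H"
  shows "\<And>b. b \<in> H \<Longrightarrow> stab b" "\<And>b. b \<in> H \<Longrightarrow> b \<noteq> {}"
    "\<And>b c. b \<in> H \<Longrightarrow> c \<in> H \<Longrightarrow> \<exists>d\<in>H. d \<subseteq> b \<inter> c"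
    "\<And>A b. meas_part M A \<Longrightarrow> (\<And>k. b k \<in> H) \<Longrightarrow> sc A b \<in> H"
  using assms by (simp_all add: stab_base_def)

text \<open>The union of a chain need not be closed under concatenations of members of different
  levels; adding them keeps all members nonempty.\<close>

lemma stab_base_chain:
  assumes C: "\<And>H. H \<in> C \<Longrightarrow> stab_base H" and chain: "\<And>H H'. H \<in> C \<Longrightarrow> H' \<in> C \<Longrightarrow> H \<subseteq> H' \<or> H' \<subseteq> H"
  shows "stab_base {sc A b | A b. meas_part M A \<and> (\<forall>k. b k \<in> \<Union>C)}" (is "stab_base ?U")
  unfolding stab_base_def
proof (intro conjI ballI allI impI)
  have st: "stab b" "b \<noteq> {}" if "b \<in> \<Union>C" for b
    using that stab_baseD(1,2)[OF C] by blast+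
  fix u assume "u \<in> ?U"
  then obtain A b where u: "u = sc A b" "meas_part M A" "\<And>k. b k \<in> \<Union>C" by blast
  show "stab u" unfolding u(1) using stab_sc[OF u(2)] st u(3) by blast
  have "\<forall>k. \<exists>f. f \<in> b k" using st u(3) by blast
  then obtain f where "\<forall>k. f k \<in> b k" by metis
  then show "u \<noteq> {}" unfolding u(1) sc_def by blast
next
  have st: "stab b" if "b \<in> \<Union>C" for b
    using that stab_baseD(1)[OF C] by blast
  fix u v assume "u \<in> ?U" "v \<in> ?U"
  then obtain A b A' b' where u: "u = sc A b" "meas_part M A" "\<And>k. b k \<in> \<Union>C"
    and v: "v = sc A' b'" "meas_part M A'" "\<And>k. b' k \<in> \<Union>C" by blast
  have "\<exists>d\<in>\<Union>C. d \<subseteq> b k \<inter> b' j" for k j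
  proof -
    \<comment> \<open>Members of two levels lie together in the larger level of the chain, which is
      directed.\<close>
    obtain H H' where H: "H \<in> C" "b k \<in> H" "H' \<in> C" "b' j \<in> H'" using u(3) v(3) by blast
    then show ?thesis using chain[OF H(1,3)] stab_baseD(3)[OF C] by (meson Union_iff subsetD)
  qed
  then obtain d where d: "\<And>k j. d k j \<in> \<Union>C" "\<And>k j. d k j \<subseteq> b k \<inter> b' j" by metis
  define e where "e n = d (fst (prod_decode n)) (snd (prod_decode n))" for n
  have e: "e n \<in> \<Union>C" for n using d(1) by (simp add: e_def)
  have dK: "d k j \<subseteq> K" for k j using stab_subset st d(1) by blast
  \<comment> \<open>The common refinement of both partitions, carrying \<open>d k j\<close> on
    \<open>A k \<inter> A' j\<close>.\<close>
  let ?P = "\<lambda>n. A (fst (prod_decode n)) \<inter> A' (snd (prod_decode n))"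
  have P: "meas_part M ?P" using meas_part_prod[OF u(2), of "\<lambda>_. A'"] v(2) by simp
  have eq: "sc ?P e = sc A (\<lambda>k. sc A' (\<lambda>j. d k j))"
    using sc_prod[OF u(2), of "\<lambda>_. A'" e] v(2) dK by (simp add: e_def)
  have "sc ?P e \<subseteq> u" unfolding eq u(1)
  proof (rule sc_mono)
    fix k
    have "sc A' (d k) \<subseteq> sc A' (\<lambda>_. b k)" using d(2) by (intro sc_mono) auto
    then show "sc A' (d k) \<subseteq> b k" using sc_const[OF st[OF u(3)] v(2)] by simp
  qed
  moreover have "sc ?P e \<subseteq> v"
  proof
    fix h assume "h \<in> sc ?P e"
    then obtain f where f: "h = cc A f" "\<forall>k. \<exists>g. f k = cc A' g \<and> (\<forall>j. g j \<in> d k j)" unfolding eq by (auto simp: sc_def)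
    then obtain g where g: "\<And>k. f k = cc A' (g k)" "\<And>k j. g k j \<in> d k j" by metis
    have gK: "g k j \<in> K" for k j using g(2) dK by blast
    have "h = cc A (\<lambda>k. cc A' (g k))" using f(1) g(1) by presburger
    \<comment> \<open>After exchanging the partitions, \<open>j\<close> is fixed in the inner
      concatenation, and all \<open>d k j\<close> lie in the stable set \<open>b' j\<close>.\<close>
    then have "h = cc A' (\<lambda>j. cc A (\<lambda>k. g k j))" using cc_swap[OF v(2) u(2), of g] gK by simp
    moreover have "cc A (\<lambda>k. g k j) \<in> b' j" for j
      using g(2) d(2) by (intro stab_cc[OF st[OF v(3)] u(2)]) blast
    ultimately show "h \<in> v" unfolding v(1) by (simp add: sc_I)
  qed
  ultimately show "\<exists>d\<in>?U. d \<subseteq> u \<inter> v" using P e by blast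
next
  fix A and w :: "nat \<Rightarrow> 'k set" assume "meas_part M A \<and> (\<forall>k. w k \<in> ?U)"
  then have A: "meas_part M A" and "\<forall>k. \<exists>A' b. w k = sc A' b \<and> meas_part M A' \<and> (\<forall>j. b j \<in> \<Union>C)" by blast+
  then obtain A' b where b: "\<And>k. w k = sc (A' k) (b k)" "\<And>k. meas_part M (A' k)" "\<And>k j. b k j \<in> \<Union>C" by metis
  \<comment> \<open>A second layer of concatenations is flattened by the pairing into a single one,
    so closing up the union of the chain once is enough.\<close>
  define e where "e n = b (fst (prod_decode n)) (snd (prod_decode n))" for n
  have e: "e n \<in> \<Union>C" for n using b(3) by (simp add: e_def)
  have "e n \<subseteq> K" for n using e stab_subset stab_baseD(1)[OF C] by blast
  moreover have "w = (\<lambda>k. sc (A' k) (\<lambda>j. e (prod_encode (k, j))))"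
    using b(1) by (simp add: e_def fun_eq_iff)
  ultimately have "sc (\<lambda>n. A (fst (prod_decode n)) \<inter> A' (fst (prod_decode n)) (snd (prod_decode n))) e = sc A w"
    using sc_prod[of A A' e, OF A b(2)] by simp
  then show "sc A w \<in> ?U"
    by (intro CollectI exI conjI[rotated] allI) (rule e, rule meas_part_prod[OF A b(2)], rule sym)
qed

lemma maximal_stab_base:
  assumes B: "stab_base B"
  obtains H where "stab_base H" "B \<subseteq> H" "\<And>H'. stab_base H' \<Longrightarrow> H \<subseteq> H' \<Longrightarrow> H' = H"
proof -
  let ?Z = "{H. stab_base H \<and> B \<subseteq> H}"
  have "\<exists>H\<in>?Z. \<forall>H'\<in>?Z. H \<subseteq> H' \<longrightarrow> H' = H"
  proof (rule subset_Zorn)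
    fix C assume chain: "subset.chain ?Z C"
    show "\<exists>U\<in>?Z. \<forall>H\<in>C. H \<subseteq> U"
    proof (cases "C = {}")
      case True
      then show ?thesis using B by blast
    next
      case False
      have C: "stab_base H \<and> B \<subseteq> H" if "H \<in> C" for H using chain that by (auto simp: subset_chain_def)
      let ?U = "{sc A b | A b. meas_part M A \<and> (\<forall>k. b k \<in> \<Union>C)}"
      have "stab_base ?U" using C chain by (intro stab_base_chain) (auto simp: subset_chain_def)
      moreover have sub: "H \<subseteq> ?U" if "H \<in> C" for H
      proof
        fix b assume b: "b \<in> H"
        \<comment> \<open>For the one-piece partition a stable set is the concatenation of copies of
          itself, so \<open>?U\<close> does contain every level of the chain.\<close>
        have P: "meas_part M (\<lambda>n :: nat. if n = 0 then space M else if n = 1 then space M - space M else {})"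
          by (rule meas_part_split) simp
        have "b = sc (\<lambda>n :: nat. if n = 0 then space M else if n = 1 then space M - space M else {}) (\<lambda>_. b)"
          using sc_const[OF _ P, of b] stab_baseD(1) C[OF that] b by metis
        then show "b \<in> ?U" using P that b by blast
      qed
      moreover have "B \<subseteq> ?U" using False C sub by (meson ex_in_conv subset_trans)
      ultimately show ?thesis by blast
    qed
  qed
  then show ?thesis using that by (smt (verit) mem_Collect_eq subset_trans)
qed

text \<open>The substitute for the ultrafilter dichotomy. All stable supersets of the traces
  \<open>b \<inter> S\<close> form a stable base that contains \<open>H\<close> and
  \<open>S\<close>, so by maximality it is \<open>H\<close>. The delicate point is its closure under
  concatenations.\<close>

lemma maximal_stab_base_meets:
  assumes H: "stab_base H" and max: "\<And>H'. stab_base H' \<Longrightarrow> H \<subseteq> H' \<Longrightarrow> H' = H" and ne: "H \<noteq> {}"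
    and S: "stab S" and meets: "\<And>b. b \<in> H \<Longrightarrow> b \<inter> S \<noteq> {}"
  shows "S \<in> H"
proof -
  let ?H = "{c. stab c \<and> (\<exists>b\<in>H. b \<inter> S \<subseteq> c)}"
  have "stab_base ?H" unfolding stab_base_def
  proof (intro conjI ballI allI impI)
    fix c assume "c \<in> ?H"
    then obtain b where b: "stab c" "b \<in> H" "b \<inter> S \<subseteq> c" by blast
    show "stab c" by fact
    show "c \<noteq> {}" using meets[OF b(2)] b(3) by blast
  next
    fix c c' assume "c \<in> ?H" "c' \<in> ?H"
    then obtain b b' where b: "b \<in> H" "b \<inter> S \<subseteq> c" "b' \<in> H" "b' \<inter> S \<subseteq> c'" by (elim CollectE conjE bexE)
    obtain d where d: "d \<in> H" "d \<subseteq> b \<inter> b'" using stab_baseD(3)[OF H b(1,3)] by blast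
    then have "d \<inter> S \<in> ?H" using stab_Int[OF stab_baseD(1)[OF H d(1)] S] by blast
    moreover have "d \<inter> S \<subseteq> c \<inter> c'" using b d by blast
    ultimately show "\<exists>d\<in>?H. d \<subseteq> c \<inter> c'" by (rule bexI[rotated])
  next
    fix A and c :: "nat \<Rightarrow> 'k set" assume "meas_part M A \<and> (\<forall>k. c k \<in> ?H)"
    then have A: "meas_part M A" and c: "\<And>k. stab (c k)" "\<forall>k. \<exists>b\<in>H. b \<inter> S \<subseteq> c k" by auto
    then obtain b where b: "\<And>k. b k \<in> H" "\<And>k. b k \<inter> S \<subseteq> c k" by metis
    have "\<forall>k. \<exists>h. h \<in> b k \<inter> S" using meets b(1) by blast
    then obtain h where h: "\<And>k. h k \<in> b k" "\<And>k. h k \<in> S" by (metis IntD1 IntD2)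
    have SK: "S \<subseteq> K" and bK: "\<And>k. b k \<subseteq> K" using stab_subset S stab_baseD(1)[OF H b(1)] by auto
    have "sc A b \<inter> S \<subseteq> sc A c"
    proof
      fix f assume "f \<in> sc A b \<inter> S"
      then obtain g where f: "f \<in> S" "f = cc A g" "\<And>k. g k \<in> b k" by (auto simp: sc_def)
      define P where "P k n = (if n = (0::nat) then A k else if n = 1 then space M - A k else {})" for k n
      have P: "meas_part M (P k)" for k
        unfolding P_def using A by (intro meas_part_split) (auto simp: meas_part_def)
      have fK: "f \<in> K" and gK: "\<And>k. g k \<in> K" and hK: "\<And>k. h k \<in> K" using f SK bK h by blast+
      have in1: "(if n = (0::nat) then f else h k) \<in> K" and in2: "(if n = (0::nat) then g k else h k) \<in> K"
        for k n using fK gK hK by auto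
      \<comment> \<open>\<open>f\<close> agrees with \<open>g k\<close> only on \<open>A k\<close>
        and need not itself belong to \<open>b k\<close>. Replacing it off \<open>A k\<close> by a
        fixed \<open>h k \<in> b k \<inter> S\<close> produces an element of both sets and keeps
        \<open>f\<close> on \<open>A k\<close>.\<close>
      define f' where "f' k = cc (P k) (\<lambda>n. if n = 0 then f else h k)" for k
      have f'K: "f' k \<in> K" for k unfolding f'_def using cc_closed[OF P in1] .
      \<comment> \<open>On \<open>A k\<close> the elements \<open>f\<close> and \<open>g k\<close>
        coincide, so \<open>f' k\<close> is equally a gluing of \<open>g k\<close> and
        \<open>h k\<close>, both taken from \<open>b k\<close>.\<close>
      have "cc (P k) (\<lambda>n. if n = 0 then g k else h k) = f' k" for k
      proof (rule cc_eqI[OF P in2 f'K])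
        fix x n assume x: "x \<in> X"
        show "AE \<omega> in M. \<omega> \<in> P k n \<longrightarrow> ev (f' k) x \<omega> = ev (if n = 0 then g k else h k) x \<omega>"
          using ev_cc[of "P k" "\<lambda>n. if n = 0 then f else h k" x n, OF P in1 x] ev_cc[of A g x k, OF A gK x] unfolding f'_def[symmetric] f(2)[symmetric]
          by eventually_elim (auto simp: P_def)
      qed
      then have "f' k \<in> b k" for k
        using stab_cc[of "b k" "P k" "\<lambda>n. if n = 0 then g k else h k"] stab_baseD(1)[OF H b(1)] P f(3) h(1) by simp
      moreover have "f' k \<in> S" for k unfolding f'_def using f(1) h(2) by (intro stab_cc[OF S P]) auto
      moreover have "cc A f' = f"
      proof (rule cc_eqI[OF A f'K fK])
        fix x k assume x: "x \<in> X"
        show "AE \<omega> in M. \<omega> \<in> A k \<longrightarrow> ev f x \<omega> = ev (f' k) x \<omega>"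
          using ev_cc[of "P k" "\<lambda>n. if n = 0 then f else h k" x 0, OF P in1 x] unfolding f'_def[symmetric]
          by eventually_elim (auto simp: P_def)
      qed
      ultimately show "f \<in> sc A c" using b(2) sc_I[of f' c A] by blast
    qed
    then show "sc A c \<in> ?H" using stab_sc[of A c, OF A c(1)] stab_baseD(4)[of H A b, OF H A b(1)] by blast
  qed
  moreover have "H \<subseteq> ?H" using stab_baseD(1)[OF H] by blast
  ultimately have "?H = H" using max by blast
  moreover have "S \<in> ?H" using S ne by blast
  ultimately show ?thesis by blast
qed

section \<open>Pointwise limits along a maximal base\<close>

lemma stab_pointwise:
  assumes x: "x \<in> X"
  shows "stab {f \<in> K. AE \<omega> in M. Q \<omega> (ev f x \<omega>)}"
  unfolding stab_def
proof (intro conjI allI impI)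
  fix A and f :: "nat \<Rightarrow> 'k" assume "meas_part M A \<and> (\<forall>k. f k \<in> {f \<in> K. AE \<omega> in M. Q \<omega> (ev f x \<omega>)})"
  then have A: "meas_part M A" and f: "\<And>k. f k \<in> K" "\<And>k. AE \<omega> in M. Q \<omega> (ev (f k) x \<omega>)" by auto
  have "AE \<omega> in M. Q \<omega> (ev (cc A f) x \<omega>)"
  proof (rule meas_part_AE[OF A])
    fix k show "AE \<omega> in M. \<omega> \<in> A k \<longrightarrow> Q \<omega> (ev (cc A f) x \<omega>)"
      using ev_cc[of A f x k, OF A f(1) x] f(2)[of k] by eventually_elim auto
  qed
  then show "cc A f \<in> {f \<in> K. AE \<omega> in M. Q \<omega> (ev f x \<omega>)}" using cc_closed[OF A f(1)] by simp
qed auto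

text \<open>The infimum is approached by countably many elements, but which of them is good depends
  on the point. Selecting the index measurably and concatenating gives a single element that is
  \<open>e\<close>-optimal almost everywhere; stability of \<open>b\<close> keeps it in
  \<open>b\<close>.\<close>

lemma ess_inf_attained:
  assumes x: "x \<in> X" and b: "stab b" "b \<noteq> {}"
  shows "\<exists>m\<in>borel_measurable M. (\<forall>f\<in>b. AE \<omega> in M. m \<omega> \<le> ev f x \<omega>) \<and>
    (\<forall>e\<in>borel_measurable M. (AE \<omega> in M. e \<omega> > 0) \<longrightarrow> (\<exists>f\<in>b. AE \<omega> in M. ev f x \<omega> \<le> m \<omega> + e \<omega>))"
proof -
  obtain c where c: "c \<in> borel_measurable M" "\<And>f. f \<in> K \<Longrightarrow> AE \<omega> in M. \<bar>ev f x \<omega>\<bar> \<le> c \<omega>"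
    using ev_bounded[OF x] by blast
  have bK: "\<And>f. f \<in> b \<Longrightarrow> f \<in> K" using stab_subset[OF b(1)] by blast
  obtain g :: "nat \<Rightarrow> 'a \<Rightarrow> real" and m where g: "range g \<subseteq> (\<lambda>f. ev f x) ` b" and m: "m \<in> borel_measurable M"
    "\<And>h. h \<in> (\<lambda>f. ev f x) ` b \<Longrightarrow> AE \<omega> in M. m \<omega> \<le> h \<omega>"
    and att: "AE \<omega> in M. \<forall>e>0. \<exists>n. g n \<omega> < m \<omega> + e"
  proof (rule countable_ess_inf[of "(\<lambda>f. ev f x) ` b" "\<lambda>\<omega>. - c \<omega>"])
    fix h assume "h \<in> (\<lambda>f. ev f x) ` b"
    then obtain f where f: "f \<in> b" "h = ev f x" by blast
    then show "h \<in> borel_measurable M" using ev_measurable[OF bK x] by blast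
    show "AE \<omega> in M. - c \<omega> \<le> h \<omega>" using c(2)[OF bK[OF f(1)]] unfolding f(2) by eventually_elim auto
  qed (use c b in auto)
  have "\<forall>n. \<exists>f\<in>b. g n = ev f x" using g by blast
  then obtain f where f: "\<And>n. f n \<in> b" "\<And>n. g n = ev (f n) x" by metis
  show ?thesis
  proof (intro bexI[OF _ m(1)] conjI ballI impI)
    show "AE \<omega> in M. m \<omega> \<le> ev h x \<omega>" if "h \<in> b" for h using m(2) that by blast
  next
    fix e :: "'a \<Rightarrow> real" assume e: "e \<in> borel_measurable M" "AE \<omega> in M. e \<omega> > 0"
    have [measurable]: "ev (f n) x \<in> borel_measurable M" for n using ev_measurable[OF bK[OF f(1)] x] .
    note [measurable] = m(1) e(1)
    obtain A where A: "meas_part M A" "\<And>n. AE \<omega> in M. \<omega> \<in> A n \<longrightarrow> ev (f n) x \<omega> \<le> m \<omega> + e \<omega>"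
    proof (rule measurable_selection_partition[of M "\<lambda>n \<omega>. ev (f n) x \<omega> \<le> m \<omega> + e \<omega>"])
      show "AE \<omega> in M. \<exists>n. ev (f n) x \<omega> \<le> m \<omega> + e \<omega>"
        using att e(2) by eventually_elim (metis f(2) less_imp_le)
    qed simp_all
    have "AE \<omega> in M. ev (cc A f) x \<omega> \<le> m \<omega> + e \<omega>"
    proof (rule meas_part_AE[OF A(1)])
      fix k show "AE \<omega> in M. \<omega> \<in> A k \<longrightarrow> ev (cc A f) x \<omega> \<le> m \<omega> + e \<omega>"
        using ev_cc[of A f x k, OF A(1) bK[OF f(1)] x] A(2)[of k] by eventually_elim auto
    qed
    then show "\<exists>f\<in>b. AE \<omega> in M. ev f x \<omega> \<le> m \<omega> + e \<omega>" using stab_cc[of b A f, OF b(1) A(1) f(1)] by blast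
  qed
qed

lemma maximal_stab_base_converges:
  assumes H: "stab_base H" and max: "\<And>H'. stab_base H' \<Longrightarrow> H \<subseteq> H' \<Longrightarrow> H' = H" and ne: "H \<noteq> {}"
    and x: "x \<in> X"
  shows "\<exists>l\<in>borel_measurable M. \<forall>e\<in>borel_measurable M. (AE \<omega> in M. e \<omega> > 0) \<longrightarrow>
    (\<exists>d\<in>H. \<forall>f\<in>d. AE \<omega> in M. \<bar>ev f x \<omega> - l \<omega>\<bar> \<le> e \<omega>)"
proof -
  note meetsI = maximal_stab_base_meets[OF H max ne]
  obtain c where c: "c \<in> borel_measurable M" "\<And>f. f \<in> K \<Longrightarrow> AE \<omega> in M. \<bar>ev f x \<omega>\<bar> \<le> c \<omega>"
    using ev_bounded[OF x] by blast
  define is_inf where "is_inf b m \<longleftrightarrow> m \<in> borel_measurable M \<and> (\<forall>f\<in>b. AE \<omega> in M. m \<omega> \<le> ev f x \<omega>) \<and>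
    (\<forall>e\<in>borel_measurable M. (AE \<omega> in M. e \<omega> > 0) \<longrightarrow> (\<exists>f\<in>b. AE \<omega> in M. ev f x \<omega> \<le> m \<omega> + e \<omega>))" for b m
  have "\<exists>m. is_inf b m" if "b \<in> H" for b
    using ess_inf_attained[OF x stab_baseD(1,2)[OF H that]] unfolding is_inf_def by blast
  then obtain m where is_inf: "\<And>b. b \<in> H \<Longrightarrow> is_inf b (m b)" by metis
  then have m: "\<And>b. b \<in> H \<Longrightarrow> m b \<in> borel_measurable M"
    "\<And>b f. b \<in> H \<Longrightarrow> f \<in> b \<Longrightarrow> AE \<omega> in M. m b \<omega> \<le> ev f x \<omega>"
    "\<And>b e. b \<in> H \<Longrightarrow> e \<in> borel_measurable M \<Longrightarrow> AE \<omega> in M. e \<omega> > 0 \<Longrightarrow> \<exists>f\<in>b. AE \<omega> in M. ev f x \<omega> \<le> m b \<omega> + e \<omega>"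
    unfolding is_inf_def by simp_all
  obtain g :: "nat \<Rightarrow> 'a \<Rightarrow> real" and l where g: "range g \<subseteq> m ` H" and l: "l \<in> borel_measurable M"
    "\<And>h. h \<in> m ` H \<Longrightarrow> AE \<omega> in M. h \<omega> \<le> l \<omega>"
    and att: "AE \<omega> in M. \<forall>e>0. \<exists>n. l \<omega> - e < g n \<omega>"
  proof (rule countable_ess_sup[of "m ` H" c])
    fix h assume "h \<in> m ` H"
    then obtain b where b: "b \<in> H" "h = m b" by blast
    then show "h \<in> borel_measurable M" using m by blast
    \<comment> \<open>A member is nonempty, and any of its elements carries the bound
      \<open>c\<close> over to its infimum; this keeps \<open>l\<close> finite.\<close>
    obtain f where f: "f \<in> b" using stab_baseD(2)[OF H b(1)] by blast
    then have "f \<in> K" using stab_subset stab_baseD(1)[OF H b(1)] by blast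
    show "AE \<omega> in M. h \<omega> \<le> c \<omega>" using c(2)[OF \<open>f \<in> K\<close>] m(2)[OF b(1) f] unfolding b(2) by eventually_elim auto
  qed (use c ne in auto)
  have "\<forall>n. \<exists>b\<in>H. g n = m b" using g by blast
  then obtain b where b: "\<And>n. b n \<in> H" "\<And>n. g n = m (b n)" by metis
  show ?thesis
  proof (intro bexI[OF _ l(1)] ballI impI)
    fix e :: "'a \<Rightarrow> real" assume e: "e \<in> borel_measurable M" "AE \<omega> in M. e \<omega> > 0"
    have [measurable]: "m (b n) \<in> borel_measurable M" for n using m(1) b(1) .
    note [measurable] = l(1) e(1)
    \<comment> \<open>No single member need come within \<open>e\<close> of the supremum everywhere,
      so the index varies with the point; \<open>sc A b\<close> is one member of \<open>H\<close>
      obeying the lower bound as a whole.\<close>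
    obtain A where A: "meas_part M A" "\<And>n. AE \<omega> in M. \<omega> \<in> A n \<longrightarrow> l \<omega> - e \<omega> \<le> m (b n) \<omega>"
    proof (rule measurable_selection_partition[of M "\<lambda>n \<omega>. l \<omega> - e \<omega> \<le> m (b n) \<omega>"])
      show "AE \<omega> in M. \<exists>n. l \<omega> - e \<omega> \<le> m (b n) \<omega>"
        using att e(2) by eventually_elim (metis b(2) less_imp_le)
    qed simp_all
    have low: "AE \<omega> in M. l \<omega> - e \<omega> \<le> ev f x \<omega>" if f: "f \<in> sc A b" for f
    proof -
      obtain h where h: "f = cc A h" "\<And>k. h k \<in> b k" using f by (auto simp: sc_def)
      then have hK: "h k \<in> K" for k using stab_subset[OF stab_baseD(1)[OF H b(1)]] by blast
      show ?thesis
      proof (rule meas_part_AE[OF A(1)])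
        fix k show "AE \<omega> in M. \<omega> \<in> A k \<longrightarrow> l \<omega> - e \<omega> \<le> ev f x \<omega>"
          using ev_cc[of A h x k, OF A(1) hK x] A(2)[of k] m(2)[OF b(1) h(2), of k]
          by eventually_elim (auto simp: h(1))
      qed
    qed
    let ?S = "{f \<in> K. AE \<omega> in M. ev f x \<omega> \<le> l \<omega> + e \<omega>}"
    \<comment> \<open>The infimum over each member is at most \<open>l\<close>, so each member has
      an element below \<open>l + e\<close>; maximality then does the rest.\<close>
    have "?S \<in> H"
    proof (rule meetsI)
      show "stab ?S" using stab_pointwise[OF x, of "\<lambda>\<omega> t. t \<le> l \<omega> + e \<omega>"] .
      fix d assume d: "d \<in> H"
      obtain f where f: "f \<in> d" "AE \<omega> in M. ev f x \<omega> \<le> m d \<omega> + e \<omega>" using m(3)[OF d e] by blast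
      have "AE \<omega> in M. m d \<omega> \<le> l \<omega>" using l(2) d by blast
      with f(2) have "AE \<omega> in M. ev f x \<omega> \<le> l \<omega> + e \<omega>" by eventually_elim auto
      then show "d \<inter> ?S \<noteq> {}" using f(1) stab_subset stab_baseD(1)[OF H d] by blast
    qed
    then obtain d where d: "d \<in> H" "d \<subseteq> sc A b \<inter> ?S"
      using stab_baseD(3)[OF H stab_baseD(4)[of H A b, OF H A(1) b(1)]] by blast
    have "AE \<omega> in M. \<bar>ev f x \<omega> - l \<omega>\<bar> \<le> e \<omega>" if "f \<in> d" for f
    proof -
      have "AE \<omega> in M. ev f x \<omega> \<le> l \<omega> + e \<omega>" using that d(2) by blast
      moreover have "AE \<omega> in M. l \<omega> - e \<omega> \<le> ev f x \<omega>" using low that d(2) by blast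
      ultimately show ?thesis by eventually_elim auto
    qed
    then show "\<exists>d\<in>H. \<forall>f\<in>d. AE \<omega> in M. \<bar>ev f x \<omega> - l \<omega>\<bar> \<le> e \<omega>" using d(1) by blast
  qed
qed

lemma stab_base_refine_convergent:
  assumes B: "stab_base B" "B \<noteq> {}"
  shows "\<exists>H l. stab_base H \<and> B \<subseteq> H \<and> (\<forall>x\<in>X. l x \<in> borel_measurable M \<and>
    (\<forall>e\<in>borel_measurable M. (AE \<omega> in M. e \<omega> > 0) \<longrightarrow>
      (\<exists>d\<in>H. \<forall>f\<in>d. AE \<omega> in M. \<bar>ev f x \<omega> - l x \<omega>\<bar> \<le> e \<omega>)))"
proof -
  obtain H where H: "stab_base H" "B \<subseteq> H" "\<And>H'. stab_base H' \<Longrightarrow> H \<subseteq> H' \<Longrightarrow> H' = H"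
    using maximal_stab_base[OF B(1)] by metis
  then have "H \<noteq> {}" using B by blast
  define is_lim where "is_lim x l \<longleftrightarrow> l \<in> borel_measurable M \<and> (\<forall>e\<in>borel_measurable M. (AE \<omega> in M. e \<omega> > 0) \<longrightarrow>
    (\<exists>d\<in>H. \<forall>f\<in>d. AE \<omega> in M. \<bar>ev f x \<omega> - l \<omega>\<bar> \<le> e \<omega>))" for x l
  have "\<exists>l. is_lim x l" if "x \<in> X" for x
    using maximal_stab_base_converges[OF H(1) _ \<open>H \<noteq> {}\<close> that] H(3) unfolding is_lim_def by blast
  then obtain l where l: "\<And>x. x \<in> X \<Longrightarrow> is_lim x (l x)" by metis
  show ?thesis
    by (intro exI[of _ H] exI[of _ l] conjI H(1,2) ballI) (use l in \<open>simp_all add: is_lim_def\<close>)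
qed

end

section \<open>Representatives and the stable topology\<close>

lemma cls_in_L0: "f \<in> borel_measurable M \<Longrightarrow> cls M f \<in> L0 M"
  by (auto simp: L0_def)

lemma cls_cong:
  assumes "AE \<omega> in M. f \<omega> = g \<omega>"
  shows "cls M f = cls M g"
proof -
  have "(AE \<omega> in M. f \<omega> = h \<omega>) = (AE \<omega> in M. g \<omega> = h \<omega>)" for h
    by (rule eventually_subst) (use assms in \<open>eventually_elim, simp\<close>)
  then show ?thesis unfolding cls_def by simp
qed

lemma rep_cls:
  assumes "f \<in> borel_measurable M"
  shows "rep (cls M f) \<in> borel_measurable M" "AE \<omega> in M. rep (cls M f) \<omega> = f \<omega>"
proof -
  have "f \<in> cls M f" using assms by (simp add: cls_def)
  then have "rep (cls M f) \<in> cls M f" unfolding rep_def by (rule someI[where P = "\<lambda>g. g \<in> cls M f"])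
  then show "rep (cls M f) \<in> borel_measurable M" "AE \<omega> in M. rep (cls M f) \<omega> = f \<omega>"
    by (auto simp: cls_def elim!: eventually_mono)
qed

lemma rep_measurable: "r \<in> L0 M \<Longrightarrow> rep r \<in> borel_measurable M"
  using rep_cls(1) by (auto simp: L0_def)

lemma cls_rep:
  assumes "r \<in> L0 M"
  shows "cls M (rep r) = r"
proof -
  obtain f where f: "f \<in> borel_measurable M" "r = cls M f" using assms by (auto simp: L0_def)
  show ?thesis unfolding f(2) by (intro cls_cong rep_cls(2) f(1))
qed

lemma L0_eqI:
  assumes "r \<in> L0 M" "s \<in> L0 M" "AE \<omega> in M. rep r \<omega> = rep s \<omega>"
  shows "r = s"
  using cls_cong[OF assms(3)] assms(1,2) by (simp add: cls_rep)

lemma l0c_L0: "l0c M c \<in> L0 M"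
  by (simp add: l0c_def cls_in_L0)

lemma rep_l0c: "AE \<omega> in M. rep (l0c M c) \<omega> = c"
  unfolding l0c_def by (rule rep_cls(2)) simp

lemma l0_add_L0: "r \<in> L0 M \<Longrightarrow> s \<in> L0 M \<Longrightarrow> l0_add M r s \<in> L0 M"
  and l0_diff_L0: "r \<in> L0 M \<Longrightarrow> s \<in> L0 M \<Longrightarrow> l0_diff M r s \<in> L0 M"
  and l0_mul_L0: "r \<in> L0 M \<Longrightarrow> s \<in> L0 M \<Longrightarrow> l0_mul M r s \<in> L0 M"
  and l0_abs_L0: "r \<in> L0 M \<Longrightarrow> l0_abs M r \<in> L0 M"
  by (auto simp: l0_add_def l0_diff_def l0_mul_def l0_abs_def intro!: cls_in_L0 dest!: rep_measurable)

lemma rep_l0_add: "r \<in> L0 M \<Longrightarrow> s \<in> L0 M \<Longrightarrow> AE \<omega> in M. rep (l0_add M r s) \<omega> = rep r \<omega> + rep s \<omega>"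
  and rep_l0_diff: "r \<in> L0 M \<Longrightarrow> s \<in> L0 M \<Longrightarrow> AE \<omega> in M. rep (l0_diff M r s) \<omega> = rep r \<omega> - rep s \<omega>"
  and rep_l0_mul: "r \<in> L0 M \<Longrightarrow> s \<in> L0 M \<Longrightarrow> AE \<omega> in M. rep (l0_mul M r s) \<omega> = rep r \<omega> * rep s \<omega>"
  and rep_l0_abs: "r \<in> L0 M \<Longrightarrow> AE \<omega> in M. rep (l0_abs M r) \<omega> = \<bar>rep r \<omega>\<bar>"
  unfolding l0_add_def l0_diff_def l0_mul_def l0_abs_def
  by (auto intro!: rep_cls(2) dest!: rep_measurable)

lemma L0ppI:
  assumes "f \<in> borel_measurable M" "AE \<omega> in M. f \<omega> > 0"
  shows "cls M f \<in> L0pp M"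
  unfolding L0pp_def l0_less_def
proof (intro CollectI conjI cls_in_L0 assms(1))
  show "AE \<omega> in M. rep (l0c M 0) \<omega> < rep (cls M f) \<omega>"
    using assms(2) rep_l0c[of M 0] rep_cls(2)[OF assms(1)] by eventually_elim simp
qed

lemma L0ppD:
  assumes "r \<in> L0pp M"
  shows "r \<in> L0 M" "AE \<omega> in M. rep r \<omega> > 0"
proof -
  show "r \<in> L0 M" using assms by (simp add: L0pp_def)
  have "AE \<omega> in M. rep (l0c M 0) \<omega> < rep r \<omega>" using assms by (simp add: L0pp_def l0_less_def)
  then show "AE \<omega> in M. rep r \<omega> > 0" using rep_l0c[of M 0] by eventually_elim simp
qed

lemma L0pD:
  assumes "r \<in> L0p M"
  shows "r \<in> L0 M" "AE \<omega> in M. rep r \<omega> \<ge> 0"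
proof -
  show "r \<in> L0 M" using assms by (simp add: L0p_def)
  have "AE \<omega> in M. rep (l0c M 0) \<omega> \<le> rep r \<omega>" using assms by (simp add: L0p_def l0_le_def)
  then show "AE \<omega> in M. rep r \<omega> \<ge> 0" using rep_l0c[of M 0] by eventually_elim simp
qed

lemma meas_part_index: "meas_part M A \<Longrightarrow> \<omega> \<in> A k \<Longrightarrow> (THE k. \<omega> \<in> A k) = k"
  by (intro the_equality) (auto simp: meas_part_def disjoint_family_on_def)

text \<open>The map sending a point to the index of its piece is measurable into a countable
  discrete space, so gluing along it preserves measurability.\<close>

lemma meas_part_glue_measurable:
  fixes g :: "nat \<Rightarrow> 'a \<Rightarrow> real"
  assumes A: "meas_part M A" and g: "\<And>k. g k \<in> borel_measurable M"
  shows "(\<lambda>\<omega>. g (THE k. \<omega> \<in> A k) \<omega>) \<in> borel_measurable M"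
proof (rule measurable_compose_countable)
  show "(\<lambda>\<omega>. THE k. \<omega> \<in> A k) \<in> measurable M (count_space UNIV)"
    unfolding measurable_count_space_eq2_countable
  proof (intro conjI ballI)
    fix k
    have "(\<lambda>\<omega>. THE k. \<omega> \<in> A k) -` {k} \<inter> space M = A k"
    proof
      show "(\<lambda>\<omega>. THE k. \<omega> \<in> A k) -` {k} \<inter> space M \<subseteq> A k"
      proof
        fix \<omega> assume \<omega>: "\<omega> \<in> (\<lambda>\<omega>. THE k. \<omega> \<in> A k) -` {k} \<inter> space M"
        then obtain j where "\<omega> \<in> A j" using A by (auto simp: meas_part_def)
        then show "\<omega> \<in> A k" using \<omega> meas_part_index[OF A] by auto
      qed
      show "A k \<subseteq> (\<lambda>\<omega>. THE k. \<omega> \<in> A k) -` {k} \<inter> space M"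
        using meas_part_index[OF A] A by (auto simp: meas_part_def)
    qed
    then show "(\<lambda>\<omega>. THE k. \<omega> \<in> A k) -` {k} \<inter> space M \<in> sets M" using A by (simp add: meas_part_def)
  qed simp
qed (rule g)

lemma l0_concat_L0: "meas_part M A \<Longrightarrow> (\<And>k. r k \<in> L0 M) \<Longrightarrow> l0_concat M A r \<in> L0 M"
  unfolding l0_concat_def
  by (intro cls_in_L0 meas_part_glue_measurable[of M A "\<lambda>k. rep (r k)"] rep_measurable)

lemma rep_l0_concat:
  assumes A: "meas_part M A" and r: "\<And>k. r k \<in> L0 M"
  shows "AE \<omega> in M. \<omega> \<in> A k \<longrightarrow> rep (l0_concat M A r) \<omega> = rep (r k) \<omega>"
proof -
  have "AE \<omega> in M. rep (l0_concat M A r) \<omega> = rep (r (THE k. \<omega> \<in> A k)) \<omega>"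
    unfolding l0_concat_def
    by (rule rep_cls(2)) (intro meas_part_glue_measurable[of M A "\<lambda>k. rep (r k)"] A rep_measurable r)
  then show ?thesis by eventually_elim (auto simp: meas_part_index[OF A])
qed

lemma l0_concat_const: "meas_part M A \<Longrightarrow> r \<in> L0 M \<Longrightarrow> l0_concat M A (\<lambda>_. r) = r"
  by (simp add: l0_concat_def cls_rep)

section \<open>Suprema in \<open>L0\<close> and the balls of the stable topology\<close>

lemma (in prob_space) l0_is_sup_exists:
  assumes S: "S \<noteq> {}" "S \<subseteq> L0 M" and u: "u \<in> L0 M" "\<And>r. r \<in> S \<Longrightarrow> l0_le M r u"
  shows "\<exists>s. l0_is_sup M S s"
proof -
  obtain g :: "nat \<Rightarrow> 'a \<Rightarrow> real" and s where g: "range g \<subseteq> rep ` S" and s: "s \<in> borel_measurable M"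
    "\<And>h. h \<in> rep ` S \<Longrightarrow> AE \<omega> in M. h \<omega> \<le> s \<omega>"
    and att: "AE \<omega> in M. \<forall>e>0. \<exists>n. s \<omega> - e < g n \<omega>"
    by (rule countable_ess_sup[of "rep ` S" "rep u"])
      (use assms in \<open>auto simp: l0_le_def intro!: rep_measurable\<close>)
  have "l0_is_sup M S (cls M s)" unfolding l0_is_sup_def
  proof (intro conjI ballI impI)
    show "cls M s \<in> L0 M" by (intro cls_in_L0 s)
    show "l0_le M r (cls M s)" if "r \<in> S" for r
    proof -
      have "AE \<omega> in M. rep r \<omega> \<le> s \<omega>" using s(2) that by blast
      then show ?thesis unfolding l0_le_def using rep_cls(2)[OF s(1)] by eventually_elim simp
    qed
    fix t assume t: "t \<in> L0 M" "\<forall>r\<in>S. l0_le M r t"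
    \<comment> \<open>Leastness is read off the countably many \<open>g n\<close>, whose exceptional
      null sets can be united, unlike those of all elements of \<open>S\<close>.\<close>
    have "AE \<omega> in M. g n \<omega> \<le> rep t \<omega>" for n
    proof -
      obtain r where "r \<in> S" "g n = rep r" using g by blast
      then show ?thesis using t by (auto simp: l0_le_def)
    qed
    then have "AE \<omega> in M. \<forall>n. g n \<omega> \<le> rep t \<omega>" by (simp add: AE_all_countable)
    then show "l0_le M (cls M s) t" unfolding l0_le_def using att rep_cls(2)[OF s(1)]
    proof eventually_elim
      case (elim \<omega>)
      have "s \<omega> \<le> rep t \<omega> + e" if e: "e > 0" for e
      proof -
        obtain n where "s \<omega> - e < g n \<omega>" using elim(2) e by blast
        then show ?thesis using elim(1) by (meson diff_le_eq less_imp_le order_trans)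
      qed
      then show ?case using elim(3) by (simp add: field_le_epsilon)
    qed
  qed
  then show ?thesis by blast
qed

text \<open>A ball asks for an existing supremum, not just for a bound. Order completeness supplies
  it as soon as the nonempty family is dominated by some measurable \<open>u\<close> strictly below
  \<open>r\<close>.\<close>

lemma (in prob_space) sballI:
  assumes y: "y \<in> mcarrier E" and N: "N \<noteq> {}" "\<And>p. p \<in> N \<Longrightarrow> p (mdiff M E x y) \<in> L0 M"
    and u: "u \<in> borel_measurable M" "\<And>p. p \<in> N \<Longrightarrow> AE \<omega> in M. rep (p (mdiff M E x y)) \<omega> \<le> u \<omega>"
    "AE \<omega> in M. u \<omega> < rep r \<omega>"
  shows "y \<in> sball M E N x r"
proof -
  have le: "l0_le M (p (mdiff M E x y)) (cls M u)" if "p \<in> N" for p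
    unfolding l0_le_def using u(2)[OF that] rep_cls(2)[OF u(1)] by eventually_elim simp
  obtain s where s: "l0_is_sup M {p (mdiff M E x y) |p. p \<in> N} s"
    using l0_is_sup_exists[of "{p (mdiff M E x y) |p. p \<in> N}" "cls M u"] N le cls_in_L0[OF u(1)] by blast
  then have "l0_le M s (cls M u)" using le cls_in_L0[OF u(1)] unfolding l0_is_sup_def by blast
  then have "l0_less M s r" unfolding l0_less_def l0_le_def
    using u(3) rep_cls(2)[OF u(1)] by eventually_elim simp
  then show ?thesis unfolding sball_def using y s by blast
qed

lemma (in prob_space) sballD:
  assumes "y \<in> sball M E N x r"
  shows "N \<noteq> {}" "\<exists>s\<in>borel_measurable M. (\<forall>p\<in>N. AE \<omega> in M. rep (p (mdiff M E x y)) \<omega> \<le> s \<omega>) \<and>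
    (AE \<omega> in M. s \<omega> < rep r \<omega>)"
proof -
  obtain s where s: "l0_is_sup M {p (mdiff M E x y) |p. p \<in> N} s" "l0_less M s r"
    using assms by (auto simp: sball_def)
  then have sL: "s \<in> L0 M" by (simp add: l0_is_sup_def)
  have "\<forall>p\<in>N. AE \<omega> in M. rep (p (mdiff M E x y)) \<omega> \<le> rep s \<omega>"
    using s(1) unfolding l0_is_sup_def l0_le_def by blast
  then show "\<exists>s\<in>borel_measurable M. (\<forall>p\<in>N. AE \<omega> in M. rep (p (mdiff M E x y)) \<omega> \<le> s \<omega>) \<and>
    (AE \<omega> in M. s \<omega> < rep r \<omega>)"
    using rep_measurable[OF sL] s(2) unfolding l0_less_def by blast
  \<comment> \<open>The empty family has no supremum in \<open>L0\<close>: every element bounds it,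
    in particular \<open>s - 1\<close>, so \<open>s\<close> could not be least.\<close>
  show "N \<noteq> {}"
  proof
    assume "N = {}"
    then have "l0_le M s (l0_diff M s (l0c M 1))"
      using s(1) l0_diff_L0[OF sL l0c_L0[of M 1]] unfolding l0_is_sup_def by blast
    then have "AE \<omega> in M. rep s \<omega> \<le> rep (l0_diff M s (l0c M 1)) \<omega>" by (simp add: l0_le_def)
    then have "AE \<omega> in M. False"
      using rep_l0_diff[OF sL l0c_L0[of M 1]] rep_l0c[of M 1] by eventually_elim simp
    then show False by simp
  qed
qed

lemma smn_concat_const:
  assumes "meas_part M A" "p \<in> extensional (mcarrier E)" "\<And>x. x \<in> mcarrier E \<Longrightarrow> p x \<in> L0 M"
  shows "smn_concat M E A (\<lambda>_. p) = p"
  using assms by (intro extensionalityI[of _ "mcarrier E"]) (auto simp: smn_concat_def l0_concat_const)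

lemma stable_finite_singleton:
  assumes "p \<in> P" "p \<in> extensional (mcarrier E)" "\<And>x. x \<in> mcarrier E \<Longrightarrow> p x \<in> L0 M"
  shows "stable_finite M E P {p}"
proof -
  obtain A where A: "meas_part M A" using meas_part_split[OF sets.top] by blast
  have const: "(\<forall>j. q j \<in> {p}) \<longleftrightarrow> q = (\<lambda>_. p)" for q :: "nat \<Rightarrow> _" by auto
  have st: "st M E {p} = {p}"
    unfolding st_def const using A smn_concat_const[OF _ assms(2,3)] by (auto intro!: exI[of _ A])
  have "{p} = {smn_concat M E A q |q. \<forall>k. q k \<in> st M E {p}}"
    unfolding st const using smn_concat_const[OF A assms(2,3)] by auto
  then show ?thesis unfolding stable_finite_def using A assms(1) by (auto intro!: exI[of _ A] exI[of _ "\<lambda>_. {p}"])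
qed

text \<open>Members of \<open>N\<close> arise from two nested concatenations, so on
  \<open>A k\<close> each agrees at almost every point with some element of the finite
  \<open>Nk k\<close>, the element varying with the point. Estimates for all of \<open>N\<close>
  thus reduce to finitely many seminorms on each piece.\<close>

lemma stable_finite_attained:
  assumes N: "stable_finite M E P N" and P: "\<And>p x. p \<in> P \<Longrightarrow> x \<in> mcarrier E \<Longrightarrow> p x \<in> L0 M"
  shows "\<exists>A Nk. meas_part M A \<and> (\<forall>k. finite (Nk k) \<and> Nk k \<subseteq> P) \<and> (\<forall>p\<in>N. \<forall>x\<in>mcarrier E. \<forall>k.
    AE \<omega> in M. \<omega> \<in> A k \<longrightarrow> (\<exists>q\<in>Nk k. rep (p x) \<omega> = rep (q x) \<omega>))"
proof -
  obtain A Nk where A: "meas_part M A" and fin: "\<forall>k. finite (Nk k) \<and> Nk k \<subseteq> P"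
    and N_eq: "N = {smn_concat M E A q | q. \<forall>k. q k \<in> st M E (Nk k)}"
    using N unfolding stable_finite_def by (elim conjE exE)
  have Nk: "\<And>k. finite (Nk k)" "\<And>k. Nk k \<subseteq> P" using fin by auto
  have "AE \<omega> in M. \<omega> \<in> A k \<longrightarrow> (\<exists>q\<in>Nk k. rep (p x) \<omega> = rep (q x) \<omega>)"
    if p: "p \<in> N" and x: "x \<in> mcarrier E" for p x k
  proof -
    obtain q where q: "p = smn_concat M E A q" "\<And>k. q k \<in> st M E (Nk k)" using p unfolding N_eq by auto
    have "\<forall>k. \<exists>B h. q k = smn_concat M E B h \<and> meas_part M B \<and> (\<forall>j. h j \<in> Nk k)"
      using q(2) by (simp add: st_def)
    then obtain B h where h: "\<And>k. q k = smn_concat M E (B k) (h k)" "\<And>k. meas_part M (B k)"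
      "\<And>k j. h k j \<in> Nk k" by metis
    have hL: "h k j x \<in> L0 M" for k j using P h(3) Nk(2) x by blast
    have qx: "q k x = l0_concat M (B k) (\<lambda>j. h k j x)" for k using h(1) x by (simp add: smn_concat_def)
    have qL: "q k x \<in> L0 M" for k unfolding qx using h(2) hL by (intro l0_concat_L0)
    have 1: "AE \<omega> in M. \<omega> \<in> A k \<longrightarrow> rep (p x) \<omega> = rep (q k x) \<omega>"
      using rep_l0_concat[of M A "\<lambda>k. q k x" k, OF A qL] x by (simp add: q(1) smn_concat_def)
    show ?thesis
    proof (rule meas_part_AE[OF h(2)[of k]])
      fix j
      have "AE \<omega> in M. \<omega> \<in> B k j \<longrightarrow> rep (q k x) \<omega> = rep (h k j x) \<omega>"
        unfolding qx using rep_l0_concat[of M "B k" "\<lambda>j. h k j x" j, OF h(2) hL] .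
      with 1 show "AE \<omega> in M. \<omega> \<in> B k j \<longrightarrow> \<omega> \<in> A k \<longrightarrow> (\<exists>q\<in>Nk k. rep (p x) \<omega> = rep (q x) \<omega>)"
        by eventually_elim (use h(3) in auto)
    qed
  qed
  then show ?thesis using A fin by blast
qed

section \<open>Basic neighbourhoods\<close>

definition gauges :: "'a measure \<Rightarrow> ('a, 'e) l0mod \<Rightarrow> ('e \<Rightarrow> 'a L0) set \<Rightarrow> (('e \<Rightarrow> 'a L0) set \<times> 'a L0) set \<Rightarrow> bool" where
  "gauges M E P I \<longleftrightarrow> finite I \<and> (\<forall>(N, e)\<in>I. stable_finite M E P N \<and> N \<noteq> {} \<and> e \<in> L0pp M)"

text \<open>The bound is not strict and is imposed on each \<open>p\<close> separately, so no
  supremum has to exist; a smaller \<open>e\<close> fits into the open ball. In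
  \<open>gauges\<close>, empty \<open>N\<close> is excluded because its balls are empty. The empty
  gauge gives the whole carrier.\<close>

definition gauge_nbhd :: "'a measure \<Rightarrow> ('a, 'e) l0mod \<Rightarrow> (('e \<Rightarrow> 'a L0) set \<times> 'a L0) set \<Rightarrow> 'e \<Rightarrow> 'e set" where
  "gauge_nbhd M E I x = {y \<in> mcarrier E. \<forall>(N, e)\<in>I. \<forall>p\<in>N. AE \<omega> in M. rep (p (mdiff M E x y)) \<omega> \<le> rep e \<omega>}"

lemma gaugesD:
  assumes "gauges M E P I"
  shows "finite I" "\<And>N e. (N, e) \<in> I \<Longrightarrow> stable_finite M E P N" "\<And>N e. (N, e) \<in> I \<Longrightarrow> N \<noteq> {}"
    "\<And>N e. (N, e) \<in> I \<Longrightarrow> e \<in> L0pp M" "\<And>N e p. (N, e) \<in> I \<Longrightarrow> p \<in> N \<Longrightarrow> p \<in> P"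
proof -
  show fin: "finite I" "\<And>N e. (N, e) \<in> I \<Longrightarrow> stable_finite M E P N" "\<And>N e. (N, e) \<in> I \<Longrightarrow> N \<noteq> {}"
    "\<And>N e. (N, e) \<in> I \<Longrightarrow> e \<in> L0pp M"
    using assms by (auto simp: gauges_def)
  show "p \<in> P" if "(N, e) \<in> I" "p \<in> N" for N e p
    using fin(2)[OF that(1)] that(2) by (auto simp: stable_finite_def)
qed

lemma gauges_Un: "gauges M E P I \<Longrightarrow> gauges M E P J \<Longrightarrow> gauges M E P (I \<union> J)"
  by (auto simp: gauges_def)

lemma gauge_nbhd_Un: "gauge_nbhd M E (I \<union> J) x = gauge_nbhd M E I x \<inter> gauge_nbhd M E J x"
  unfolding gauge_nbhd_def by blast

text \<open>Stated through the triangle inequality for differences, so that it serves both the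
  topology of \<open>E\<close> and the weak topology of the dual. A generating ball containing
  \<open>x\<close> need not be centred at \<open>x\<close>, which is where the inequality
  enters.\<close>

lemma (in prob_space) Ts_open_gauge_nbhd:
  assumes P: "\<And>p x y. p \<in> P \<Longrightarrow> x \<in> mcarrier E \<Longrightarrow> y \<in> mcarrier E \<Longrightarrow> p (mdiff M E x y) \<in> L0 M"
    and tri: "\<And>p x y z. p \<in> P \<Longrightarrow> x \<in> mcarrier E \<Longrightarrow> y \<in> mcarrier E \<Longrightarrow> z \<in> mcarrier E \<Longrightarrow>
      AE \<omega> in M. rep (p (mdiff M E x z)) \<omega> \<le> rep (p (mdiff M E x y)) \<omega> + rep (p (mdiff M E y z)) \<omega>"
    and W: "openin (Ts M E P) W" "x \<in> W"
  shows "\<exists>I. gauges M E P I \<and> gauge_nbhd M E I x \<subseteq> W"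
proof -
  have "generate_topology_on {sball M E N x r | N x r. stable_finite M E P N \<and> x \<in> mcarrier E \<and> r \<in> L0pp M} W"
    using W(1) unfolding Ts_def by (rule openin_topology_generated_by)
  then show ?thesis using W(2)
  proof induction
    case (Int V W)
    then obtain I J where I: "gauges M E P I" "gauge_nbhd M E I x \<subseteq> V"
      and J: "gauges M E P J" "gauge_nbhd M E J x \<subseteq> W" by blast
    then show ?case using gauges_Un[OF I(1) J(1)] gauge_nbhd_Un[of M E I J x] by blast
  next
    case (UN K)
    then show ?case by blast
  next
    case (Basis V)
    then obtain N z r where V: "V = sball M E N z r" and N: "stable_finite M E P N" and z: "z \<in> mcarrier E"
      and r: "r \<in> L0pp M" by blast
    have x: "x \<in> mcarrier E" using Basis(2) by (simp add: V sball_def)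
    obtain s where s: "s \<in> borel_measurable M" "\<And>p. p \<in> N \<Longrightarrow> AE \<omega> in M. rep (p (mdiff M E z x)) \<omega> \<le> s \<omega>"
      "AE \<omega> in M. s \<omega> < rep r \<omega>"
      using sballD(2)[OF Basis(2)[unfolded V]] by blast
    have "N \<noteq> {}" using sballD(1)[OF Basis(2)[unfolded V]] .
    \<comment> \<open>\<open>s\<close> bounds the distance from the centre \<open>z\<close> to
      \<open>x\<close>. Half of the slack \<open>r - s\<close> keeps \<open>y\<close> within
      \<open>(r + s) / 2\<close> of \<open>z\<close>, strictly below \<open>r\<close>.\<close>
    define e where "e = cls M (\<lambda>\<omega>. (rep r \<omega> - s \<omega>) / 2)"
    have r_meas[measurable]: "rep r \<in> borel_measurable M" using rep_measurable[OF L0ppD(1)[OF r]] .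
    note [measurable] = s(1)
    have e: "e \<in> L0pp M" unfolding e_def
    proof (rule L0ppI)
      show "AE \<omega> in M. 0 < (rep r \<omega> - s \<omega>) / 2" using s(3) by eventually_elim simp
    qed simp
    have rep_e: "AE \<omega> in M. rep e \<omega> = (rep r \<omega> - s \<omega>) / 2" unfolding e_def by (rule rep_cls(2)) simp
    have NP: "\<And>p. p \<in> N \<Longrightarrow> p \<in> P" using N by (auto simp: stable_finite_def)
    have "gauge_nbhd M E {(N, e)} x \<subseteq> V"
    proof
      fix y assume "y \<in> gauge_nbhd M E {(N, e)} x"
      then have y: "y \<in> mcarrier E" "\<And>p. p \<in> N \<Longrightarrow> AE \<omega> in M. rep (p (mdiff M E x y)) \<omega> \<le> rep e \<omega>"
        by (auto simp: gauge_nbhd_def)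
      show "y \<in> V" unfolding V
      proof (rule sballI[of _ _ _ _ "\<lambda>\<omega>. (rep r \<omega> + s \<omega>) / 2"])
        show "p (mdiff M E z y) \<in> L0 M" if "p \<in> N" for p using P NP[OF that] z y(1) by blast
        show "AE \<omega> in M. rep (p (mdiff M E z y)) \<omega> \<le> (rep r \<omega> + s \<omega>) / 2" if "p \<in> N" for p
          using tri[OF NP[OF that] z x y(1)] s(2)[OF that] y(2)[OF that] rep_e
          by eventually_elim (simp add: field_simps)
        show "AE \<omega> in M. (rep r \<omega> + s \<omega>) / 2 < rep r \<omega>" using s(3) by eventually_elim simp
      qed (use y \<open>N \<noteq> {}\<close> in simp_all)
    qed
    moreover have "gauges M E P {(N, e)}" using N e \<open>N \<noteq> {}\<close> by (simp add: gauges_def)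
    ultimately show ?case by blast
  qed simp
qed

section \<open>Continuous functionals\<close>

locale l0_seminormed = prob_space M for M :: "'a measure" +
  fixes E :: "('a, 'e) l0mod" and P :: "('e \<Rightarrow> 'a L0) set"
  assumes l0_module: "l0_module M E"
    and seminorms: "\<And>p. p \<in> P \<Longrightarrow> l0_seminorm M E p"
    and P_nonempty: "P \<noteq> {}"
begin

section \<open>Module and seminorm calculus\<close>

lemma zero_closed: "mzero E \<in> mcarrier E"
  and add_closed: "x \<in> mcarrier E \<Longrightarrow> y \<in> mcarrier E \<Longrightarrow> madd E x y \<in> mcarrier E"
  and smul_closed: "r \<in> L0 M \<Longrightarrow> x \<in> mcarrier E \<Longrightarrow> msmul E r x \<in> mcarrier E"
  and add_comm: "x \<in> mcarrier E \<Longrightarrow> y \<in> mcarrier E \<Longrightarrow> madd E x y = madd E y x"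
  and add_zero: "x \<in> mcarrier E \<Longrightarrow> madd E x (mzero E) = x"
  and add_neg: "x \<in> mcarrier E \<Longrightarrow> madd E x (msmul E (l0c M (-1)) x) = mzero E"
  and smul_add: "r \<in> L0 M \<Longrightarrow> s \<in> L0 M \<Longrightarrow> x \<in> mcarrier E \<Longrightarrow>
    msmul E (l0_add M r s) x = madd E (msmul E r x) (msmul E s x)"
  and smul_one: "x \<in> mcarrier E \<Longrightarrow> msmul E (l0c M 1) x = x"
  using l0_module unfolding l0_module_def by simp_all

lemma add_assoc:
  assumes "x \<in> mcarrier E" "y \<in> mcarrier E" "z \<in> mcarrier E"
  shows "madd E (madd E x y) z = madd E x (madd E y z)"
proof -
  have "\<forall>x\<in>mcarrier E. \<forall>y\<in>mcarrier E. \<forall>z\<in>mcarrier E. madd E (madd E x y) z = madd E x (madd E y z)"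
    using l0_module unfolding l0_module_def by (elim conjE)
  then show ?thesis using assms by blast
qed

lemma diff_closed: "x \<in> mcarrier E \<Longrightarrow> y \<in> mcarrier E \<Longrightarrow> mdiff M E x y \<in> mcarrier E"
  by (simp add: mdiff_def add_closed smul_closed l0c_L0)

lemma diff_self: "x \<in> mcarrier E \<Longrightarrow> mdiff M E x x = mzero E"
  by (simp add: mdiff_def add_neg)

lemma zero_diff: "x \<in> mcarrier E \<Longrightarrow> mdiff M E (mzero E) x = msmul E (l0c M (-1)) x"
  unfolding mdiff_def
  by (subst add_comm) (simp_all add: add_zero smul_closed l0c_L0 zero_closed)

lemma diff_add_diff:
  assumes "x \<in> mcarrier E" "y \<in> mcarrier E" "z \<in> mcarrier E"
  shows "madd E (mdiff M E x y) (mdiff M E y z) = mdiff M E x z"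
proof -
  let ?n = "msmul E (l0c M (-1))"
  have n: "?n u \<in> mcarrier E" if "u \<in> mcarrier E" for u using that by (simp add: smul_closed l0c_L0)
  have "madd E (mdiff M E x y) (mdiff M E y z) = madd E x (madd E (?n y) (madd E y (?n z)))"
    using assms n by (simp add: mdiff_def add_assoc add_closed)
  also have "madd E (?n y) (madd E y (?n z)) = madd E (madd E y (?n y)) (?n z)"
    using assms n by (metis add_assoc add_comm)
  also have "\<dots> = ?n z"
    using assms n by (simp add: add_neg add_comm[of "mzero E"] zero_closed add_zero)
  finally show ?thesis by (simp add: mdiff_def)
qed

lemma zero_smul:
  assumes "x \<in> mcarrier E"
  shows "msmul E (l0c M 0) x = mzero E"
proof -
  have "l0_add M (l0c M 1) (l0c M (-1)) = l0c M 0"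
  proof (rule L0_eqI)
    show "AE \<omega> in M. rep (l0_add M (l0c M 1) (l0c M (- 1))) \<omega> = rep (l0c M 0) \<omega>"
      using rep_l0_add[OF l0c_L0[of M 1] l0c_L0[of M "-1"]] rep_l0c[of M 1] rep_l0c[of M "-1"] rep_l0c[of M 0]
      by eventually_elim simp
  qed (simp_all add: l0c_L0 l0_add_L0)
  then show ?thesis using smul_add[OF l0c_L0[of M 1] l0c_L0[of M "-1"] assms] add_neg[OF assms] smul_one[OF assms] by simp
qed

lemma seminorm_L0:
  assumes "p \<in> P" "x \<in> mcarrier E"
  shows "p x \<in> L0 M" "AE \<omega> in M. rep (p x) \<omega> \<ge> 0"
proof -
  have "p x \<in> L0p M" using seminorms[OF assms(1)] assms(2) by (simp add: l0_seminorm_def)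
  then show "p x \<in> L0 M" "AE \<omega> in M. rep (p x) \<omega> \<ge> 0" by (rule L0pD)+
qed

lemma seminorm_extensional: "p \<in> P \<Longrightarrow> p \<in> extensional (mcarrier E)"
  using seminorms by (simp add: l0_seminorm_def)

lemma seminorm_smul:
  assumes "p \<in> P" "x \<in> mcarrier E" "r \<in> L0 M"
  shows "AE \<omega> in M. rep (p (msmul E r x)) \<omega> = \<bar>rep r \<omega>\<bar> * rep (p x) \<omega>"
proof -
  have "p (msmul E r x) = l0_mul M (l0_abs M r) (p x)"
    using seminorms[OF assms(1)] assms(2,3) by (simp add: l0_seminorm_def)
  moreover have "AE \<omega> in M. rep (l0_mul M (l0_abs M r) (p x)) \<omega> = \<bar>rep r \<omega>\<bar> * rep (p x) \<omega>"
    using rep_l0_mul[OF l0_abs_L0[OF assms(3)] seminorm_L0(1)[OF assms(1,2)]] rep_l0_abs[OF assms(3)]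
    by eventually_elim simp
  ultimately show ?thesis by simp
qed

lemma seminorm_neg:
  assumes "p \<in> P" "x \<in> mcarrier E"
  shows "AE \<omega> in M. rep (p (msmul E (l0c M (-1)) x)) \<omega> = rep (p x) \<omega>"
  using seminorm_smul[OF assms l0c_L0[of M "-1"]] rep_l0c[of M "-1"] by eventually_elim simp

lemma seminorm_zero:
  assumes "p \<in> P"
  shows "AE \<omega> in M. rep (p (mzero E)) \<omega> = 0"
  using seminorm_smul[OF assms zero_closed l0c_L0[of M 0]] rep_l0c[of M 0]
  unfolding zero_smul[OF zero_closed] by eventually_elim simp

lemma seminorm_triangle:
  assumes p: "p \<in> P" and x: "x \<in> mcarrier E" "y \<in> mcarrier E" "z \<in> mcarrier E"
  shows "AE \<omega> in M. rep (p (mdiff M E x z)) \<omega> \<le> rep (p (mdiff M E x y)) \<omega> + rep (p (mdiff M E y z)) \<omega>"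
proof -
  have "l0_le M (p (mdiff M E x z)) (l0_add M (p (mdiff M E x y)) (p (mdiff M E y z)))"
    using seminorms[OF p] diff_closed[OF x(1,2)] diff_closed[OF x(2,3)] diff_add_diff[OF x]
    unfolding l0_seminorm_def by metis
  then have "AE \<omega> in M. rep (p (mdiff M E x z)) \<omega> \<le> rep (l0_add M (p (mdiff M E x y)) (p (mdiff M E y z))) \<omega>"
    by (simp add: l0_le_def)
  then show ?thesis
    using rep_l0_add[OF seminorm_L0(1)[OF p diff_closed[OF x(1,2)]] seminorm_L0(1)[OF p diff_closed[OF x(2,3)]]]
    by eventually_elim simp
qed

lemma open_gauge_nbhd:
  assumes "openin (Ts M E P) W" "x \<in> W"
  shows "\<exists>I. gauges M E P I \<and> gauge_nbhd M E I x \<subseteq> W"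
  by (rule Ts_open_gauge_nbhd[OF _ seminorm_triangle assms]) (auto intro: seminorm_L0 diff_closed)

lemma center_sball:
  assumes N: "N \<noteq> {}" "N \<subseteq> P" and x: "x \<in> mcarrier E" and r: "r \<in> L0pp M"
  shows "x \<in> sball M E N x r"
proof (rule sballI[of _ _ _ _ "\<lambda>_. 0"])
  fix p assume "p \<in> N"
  then have p: "p \<in> P" using N by blast
  show "p (mdiff M E x x) \<in> L0 M" using seminorm_L0(1)[OF p diff_closed[OF x x]] .
  show "AE \<omega> in M. rep (p (mdiff M E x x)) \<omega> \<le> 0"
    using seminorm_zero[OF p] unfolding diff_self[OF x] by eventually_elim simp
qed (use N x L0ppD(2)[OF r] in auto)

lemma sball_open: "stable_finite M E P N \<Longrightarrow> x \<in> mcarrier E \<Longrightarrow> r \<in> L0pp M \<Longrightarrow> openin (Ts M E P) (sball M E N x r)"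
  unfolding Ts_def by (rule topology_generated_by_Basis) blast

lemma topspace_Ts: "topspace (Ts M E P) = mcarrier E"
proof
  show "topspace (Ts M E P) \<subseteq> mcarrier E" by (auto simp: Ts_def sball_def)
  show "mcarrier E \<subseteq> topspace (Ts M E P)"
  proof
    fix x assume x: "x \<in> mcarrier E"
    obtain p where p: "p \<in> P" using P_nonempty by blast
    have one: "l0c M 1 \<in> L0pp M" unfolding l0c_def by (rule L0ppI) auto
    have "stable_finite M E P {p}"
      using p seminorm_extensional[OF p] seminorm_L0(1)[OF p] by (rule stable_finite_singleton)
    then have "openin (Ts M E P) (sball M E {p} x (l0c M 1))" using x one by (rule sball_open)
    moreover have "x \<in> sball M E {p} x (l0c M 1)" using p x one by (intro center_sball) auto
    ultimately show "x \<in> topspace (Ts M E P)" using openin_subset by blast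
  qed
qed

text \<open>\<open>l0_linear\<close> leaves the range of \<open>f\<close> open; here values in
  \<open>L0 M\<close> are required. For elements of the dual this comes from continuity, as
  \<open>L0top M\<close> has no other points.\<close>

definition l0_functional :: "('e \<Rightarrow> 'a L0) \<Rightarrow> bool" where
  "l0_functional f \<longleftrightarrow> f \<in> extensional (mcarrier E) \<and> l0_linear M E f \<and> (\<forall>x\<in>mcarrier E. f x \<in> L0 M)"

lemma functional_L0: "l0_functional f \<Longrightarrow> x \<in> mcarrier E \<Longrightarrow> f x \<in> L0 M"
  by (simp add: l0_functional_def)

lemma functional_add:
  assumes "l0_functional f" "x \<in> mcarrier E" "y \<in> mcarrier E"
  shows "AE \<omega> in M. rep (f (madd E x y)) \<omega> = rep (f x) \<omega> + rep (f y) \<omega>"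
proof -
  have "f (madd E x y) = l0_add M (f x) (f y)" using assms by (simp add: l0_functional_def l0_linear_def)
  then show ?thesis using rep_l0_add functional_L0[OF assms(1)] assms(2,3) by metis
qed

lemma functional_smul:
  assumes "l0_functional f" "r \<in> L0 M" "x \<in> mcarrier E"
  shows "AE \<omega> in M. rep (f (msmul E r x)) \<omega> = rep r \<omega> * rep (f x) \<omega>"
proof -
  have "f (msmul E r x) = l0_mul M r (f x)" using assms by (simp add: l0_functional_def l0_linear_def)
  then show ?thesis using rep_l0_mul functional_L0[OF assms(1)] assms(2,3) by metis
qed

lemma functionalI:
  assumes "f \<in> extensional (mcarrier E)" "\<And>x. x \<in> mcarrier E \<Longrightarrow> f x \<in> L0 M"
    and "\<And>x y. x \<in> mcarrier E \<Longrightarrow> y \<in> mcarrier E \<Longrightarrow> AE \<omega> in M. rep (f (madd E x y)) \<omega> = rep (f x) \<omega> + rep (f y) \<omega>"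
    and "\<And>r x. r \<in> L0 M \<Longrightarrow> x \<in> mcarrier E \<Longrightarrow> AE \<omega> in M. rep (f (msmul E r x)) \<omega> = rep r \<omega> * rep (f x) \<omega>"
  shows "l0_functional f"
  unfolding l0_functional_def l0_linear_def
proof (intro conjI ballI assms(1,2))
  fix x y assume x: "x \<in> mcarrier E" and y: "y \<in> mcarrier E"
  show "f (madd E x y) = l0_add M (f x) (f y)"
  proof (rule L0_eqI)
    show "AE \<omega> in M. rep (f (madd E x y)) \<omega> = rep (l0_add M (f x) (f y)) \<omega>"
      using assms(3)[OF x y] rep_l0_add[OF assms(2)[OF x] assms(2)[OF y]] by eventually_elim simp
  qed (simp_all add: x y assms(2) add_closed l0_add_L0)
next
  fix r x assume r: "r \<in> L0 M" and x: "x \<in> mcarrier E"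
  show "f (msmul E r x) = l0_mul M r (f x)"
  proof (rule L0_eqI)
    show "AE \<omega> in M. rep (f (msmul E r x)) \<omega> = rep (l0_mul M r (f x)) \<omega>"
      using assms(4)[OF r x] rep_l0_mul[OF r assms(2)[OF x]] by eventually_elim simp
  qed (simp_all add: x r assms(2) smul_closed l0_mul_L0)
qed

lemma functional_neg:
  assumes "l0_functional f" "x \<in> mcarrier E"
  shows "AE \<omega> in M. rep (f (msmul E (l0c M (-1)) x)) \<omega> = - rep (f x) \<omega>"
  using functional_smul[OF assms(1) l0c_L0[of M "-1"] assms(2)] rep_l0c[of M "-1"] by eventually_elim simp

lemma functional_diff:
  assumes "l0_functional f" "x \<in> mcarrier E" "y \<in> mcarrier E"
  shows "AE \<omega> in M. rep (f (mdiff M E x y)) \<omega> = rep (f x) \<omega> - rep (f y) \<omega>"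
  using functional_add[OF assms(1,2) smul_closed[OF l0c_L0[of M "-1"] assms(3)]] functional_neg[OF assms(1,3)]
  unfolding mdiff_def by eventually_elim simp

text \<open>The scaling factor may vary over the probability space. The scalars used are
  \<open>-1\<close>, \<open>2\<close>, the reciprocal of a random tolerance, and an absorbing
  factor.\<close>

lemma smul_gauge_nbhd_zero:
  assumes I: "gauges M E P I" and d: "d \<in> L0 M" and y: "y \<in> mcarrier E"
    and le: "\<And>N e p. (N, e) \<in> I \<Longrightarrow> p \<in> N \<Longrightarrow> AE \<omega> in M. \<bar>rep d \<omega>\<bar> * rep (p y) \<omega> \<le> rep e \<omega>"
  shows "msmul E d y \<in> gauge_nbhd M E I (mzero E)"
  unfolding gauge_nbhd_def
proof (intro CollectI conjI ballI)
  show dy: "msmul E d y \<in> mcarrier E" using d y by (rule smul_closed)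
  fix Ne assume Ne: "Ne \<in> I"
  obtain N e where Ne_eq: "Ne = (N, e)" by (cases Ne)
  have "AE \<omega> in M. rep (p (mdiff M E (mzero E) (msmul E d y))) \<omega> \<le> rep e \<omega>" if p: "p \<in> N" for p
  proof -
    have N: "(N, e) \<in> I" using Ne Ne_eq by simp
    note pP = gaugesD(5)[OF I N p]
    show ?thesis unfolding zero_diff[OF dy]
      using seminorm_neg[OF pP dy] seminorm_smul[OF pP y d] le[OF N p] by eventually_elim simp
  qed
  then show "case Ne of (N, e) \<Rightarrow> \<forall>p\<in>N. AE \<omega> in M. rep (p (mdiff M E (mzero E) (msmul E d y))) \<omega> \<le> rep e \<omega>"
    by (simp add: Ne_eq)
qed

lemma gauge_nbhd_zeroD:
  assumes I: "gauges M E P I" and y: "y \<in> gauge_nbhd M E I (mzero E)" and N: "(N, e) \<in> I" "p \<in> N"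
  shows "AE \<omega> in M. rep (p y) \<omega> \<le> rep e \<omega>"
proof -
  have y': "y \<in> mcarrier E" and le: "AE \<omega> in M. rep (p (mdiff M E (mzero E) y)) \<omega> \<le> rep e \<omega>"
    using y N by (auto simp: gauge_nbhd_def)
  from le show ?thesis using seminorm_neg[OF gaugesD(5)[OF I N] y'] unfolding zero_diff[OF y'] by eventually_elim simp
qed

text \<open>Seminorms ignore signs, so the neighbourhood is symmetric; the one-sided bound at
  \<open>y\<close> and at \<open>-y\<close> gives the absolute value.\<close>

lemma functional_abs_le_on_gauge_nbhd:
  assumes f: "l0_functional f" and I: "gauges M E P I"
    and le: "\<And>x. x \<in> gauge_nbhd M E I (mzero E) \<Longrightarrow> AE \<omega> in M. rep (f x) \<omega> \<le> 1"
    and y: "y \<in> gauge_nbhd M E I (mzero E)"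
  shows "AE \<omega> in M. \<bar>rep (f y) \<omega>\<bar> \<le> 1"
proof -
  have y': "y \<in> mcarrier E" using y by (simp add: gauge_nbhd_def)
  have "msmul E (l0c M (-1)) y \<in> gauge_nbhd M E I (mzero E)"
  proof (rule smul_gauge_nbhd_zero[OF I l0c_L0 y'])
    fix N e p assume N: "(N, e) \<in> I" "p \<in> N"
    show "AE \<omega> in M. \<bar>rep (l0c M (- 1)) \<omega>\<bar> * rep (p y) \<omega> \<le> rep e \<omega>"
      using gauge_nbhd_zeroD[OF I y N] rep_l0c[of M "-1"] by eventually_elim simp
  qed
  from le[OF this] le[OF y] functional_neg[OF f y'] show ?thesis by eventually_elim auto
qed

text \<open>Rescaling: if \<open>(x - y) / \<delta>\<close> lies in the neighbourhood on which
  \<open>f\<close> is bounded, then \<open>f x\<close> and \<open>f y\<close> differ by at most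
  \<open>\<delta>\<close>, and \<open>\<delta>\<close> may be any a.e. positive random
  variable.\<close>

lemma functional_continuous:
  assumes f: "l0_functional f" and I: "gauges M E P I"
    and le: "\<And>x. x \<in> gauge_nbhd M E I (mzero E) \<Longrightarrow> AE \<omega> in M. rep (f x) \<omega> \<le> 1"
  shows "continuous_map (Ts M E P) (L0top M) f"
  unfolding L0top_def
proof (rule continuous_on_generated_topo)
  have one: "l0c M 1 \<in> L0pp M" unfolding l0c_def by (rule L0ppI) auto
  show "f ` topspace (Ts M E P) \<subseteq> \<Union> {{s \<in> L0 M. l0_less M (l0_abs M (l0_diff M s t)) r} |t r. t \<in> L0 M \<and> r \<in> L0pp M}"
  proof
    fix s assume "s \<in> f ` topspace (Ts M E P)"
    then have s: "s \<in> L0 M" using functional_L0[OF f] by (auto simp: topspace_Ts)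
    have "l0_less M (l0_abs M (l0_diff M s s)) (l0c M 1)" unfolding l0_less_def
      using rep_l0_abs[OF l0_diff_L0[OF s s]] rep_l0_diff[OF s s] rep_l0c[of M 1] by eventually_elim simp
    then show "s \<in> \<Union> {{s \<in> L0 M. l0_less M (l0_abs M (l0_diff M s t)) r} |t r. t \<in> L0 M \<and> r \<in> L0pp M}"
      using s one by blast
  qed
  fix U assume "U \<in> {{s \<in> L0 M. l0_less M (l0_abs M (l0_diff M s t)) r} |t r. t \<in> L0 M \<and> r \<in> L0pp M}"
  then obtain t r where U: "U = {s \<in> L0 M. l0_less M (l0_abs M (l0_diff M s t)) r}"
    and t: "t \<in> L0 M" and r: "r \<in> L0pp M" by blast
  have U_iff: "s \<in> U \<longleftrightarrow> (AE \<omega> in M. \<bar>rep s \<omega> - rep t \<omega>\<bar> < rep r \<omega>)" if s: "s \<in> L0 M" for s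
  proof -
    have eq: "AE \<omega> in M. rep (l0_abs M (l0_diff M s t)) \<omega> = \<bar>rep s \<omega> - rep t \<omega>\<bar>"
      using rep_l0_abs[OF l0_diff_L0[OF s t]] rep_l0_diff[OF s t] by eventually_elim simp
    have "(AE \<omega> in M. rep (l0_abs M (l0_diff M s t)) \<omega> < rep r \<omega>) = (AE \<omega> in M. \<bar>rep s \<omega> - rep t \<omega>\<bar> < rep r \<omega>)"
      by (rule eventually_subst) (use eq in \<open>eventually_elim, simp\<close>)
    then show ?thesis using s by (simp add: U l0_less_def)
  qed
  show "openin (Ts M E P) (f -` U \<inter> topspace (Ts M E P))"
  proof (subst openin_subopen, intro ballI)
    fix x assume "x \<in> f -` U \<inter> topspace (Ts M E P)"
    then have x: "x \<in> mcarrier E" "f x \<in> U" by (auto simp: topspace_Ts)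
    have fx: "AE \<omega> in M. \<bar>rep (f x) \<omega> - rep t \<omega>\<bar> < rep r \<omega>" using U_iff[OF functional_L0[OF f x(1)]] x(2) by simp
    have [measurable]: "rep (f x) \<in> borel_measurable M" "rep t \<in> borel_measurable M" "rep r \<in> borel_measurable M"
      using rep_measurable functional_L0[OF f x(1)] t L0ppD(1)[OF r] by auto
    \<comment> \<open>Half the gap between \<open>r\<close> and the distance of \<open>f x\<close>
      from \<open>t\<close>, so that a change of \<open>f\<close> by at most \<open>\<delta>\<close>
      still leaves a strict inequality.\<close>
    define \<delta> where "\<delta> \<omega> = (rep r \<omega> - \<bar>rep (f x) \<omega> - rep t \<omega>\<bar>) / 2" for \<omega>
    have [measurable]: "\<delta> \<in> borel_measurable M" unfolding \<delta>_def by measurable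
    have \<delta>_pos: "AE \<omega> in M. \<delta> \<omega> > 0" using fx by eventually_elim (simp add: \<delta>_def)
    define i where "i = cls M (\<lambda>\<omega>. 1 / \<delta> \<omega>)"
    have iL: "i \<in> L0 M" unfolding i_def by (intro cls_in_L0) simp
    have rep_i: "AE \<omega> in M. rep i \<omega> = 1 / \<delta> \<omega>" unfolding i_def by (rule rep_cls(2)) simp
    define R where "R e = cls M (\<lambda>\<omega>. \<delta> \<omega> * rep e \<omega>)" for e
    have R: "R e \<in> L0pp M" "AE \<omega> in M. rep (R e) \<omega> = \<delta> \<omega> * rep e \<omega>" if "(N, e) \<in> I" for N e
    proof -
      have e: "e \<in> L0pp M" using gaugesD(4)[OF I that] .
      have [measurable]: "rep e \<in> borel_measurable M" using rep_measurable[OF L0ppD(1)[OF e]] .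
      show "R e \<in> L0pp M" unfolding R_def
      proof (rule L0ppI)
        show "AE \<omega> in M. 0 < \<delta> \<omega> * rep e \<omega>" using \<delta>_pos L0ppD(2)[OF e] by eventually_elim simp
      qed simp
      show "AE \<omega> in M. rep (R e) \<omega> = \<delta> \<omega> * rep e \<omega>" unfolding R_def by (rule rep_cls(2)) simp
    qed
    \<comment> \<open>Intersecting with the whole space covers the empty gauge, for which the
      intersection of balls alone would be the universal set of the type.\<close>
    define T where "T = topspace (Ts M E P) \<inter> (\<Inter>(N, e)\<in>I. sball M E N x (R e))"
    have "openin (Ts M E P) T" unfolding T_def
    proof (cases "I = {}")
      case False
      then show "openin (Ts M E P) (topspace (Ts M E P) \<inter> (\<Inter>(N, e)\<in>I. sball M E N x (R e)))"
        using gaugesD(1,2)[OF I] R(1) x(1) by (intro openin_Int openin_INT) (auto intro!: sball_open)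
    qed simp
    moreover have "x \<in> T" unfolding T_def using x(1) R(1) gaugesD(3,5)[OF I]
      by (auto simp: topspace_Ts intro!: center_sball)
    moreover have "T \<subseteq> f -` U \<inter> topspace (Ts M E P)"
    proof
      fix y assume y: "y \<in> T"
      then have y': "y \<in> mcarrier E" by (auto simp: T_def topspace_Ts)
      note d = diff_closed[OF x(1) y']
      have "msmul E i (mdiff M E x y) \<in> gauge_nbhd M E I (mzero E)"
      proof (rule smul_gauge_nbhd_zero[OF I iL d])
        fix N e p assume N: "(N, e) \<in> I" "p \<in> N"
        have ball: "y \<in> sball M E N x (R e)" using y N(1) by (auto simp: T_def)
        obtain s where s: "AE \<omega> in M. rep (p (mdiff M E x y)) \<omega> \<le> s \<omega>" "AE \<omega> in M. s \<omega> < rep (R e) \<omega>"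
          using sballD(2)[OF ball] N(2) by blast
        show "AE \<omega> in M. \<bar>rep i \<omega>\<bar> * rep (p (mdiff M E x y)) \<omega> \<le> rep e \<omega>"
          using s rep_i \<delta>_pos R(2)[OF N(1)]
        proof eventually_elim
          case (elim \<omega>)
          then have "rep (p (mdiff M E x y)) \<omega> \<le> rep e \<omega> * \<delta> \<omega>" by (simp add: mult.commute)
          then show ?case using elim(3,4) by (simp add: pos_divide_le_eq)
        qed
      qed
      then have "AE \<omega> in M. \<bar>rep (f (msmul E i (mdiff M E x y))) \<omega>\<bar> \<le> 1"
        using functional_abs_le_on_gauge_nbhd[OF f I] le by blast
      from this functional_smul[OF f iL d] functional_diff[OF f x(1) y']
        rep_i \<delta>_pos fx
      have "AE \<omega> in M. \<bar>rep (f y) \<omega> - rep t \<omega>\<bar> < rep r \<omega>"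
      proof eventually_elim
        case (elim \<omega>)
        then have "\<bar>rep (f x) \<omega> - rep (f y) \<omega>\<bar> \<le> \<delta> \<omega>" by (simp add: abs_mult pos_divide_le_eq)
        then show ?case using elim(5) unfolding \<delta>_def by argo
      qed
      then show "y \<in> f -` U \<inter> topspace (Ts M E P)"
        using U_iff[OF functional_L0[OF f y']] y' by (simp add: topspace_Ts)
    qed
    ultimately show "\<exists>T. openin (Ts M E P) T \<and> x \<in> T \<and> T \<subseteq> f -` U \<inter> topspace (Ts M E P)" by blast
  qed
qed

text \<open>One direction takes the preimage of the unit ball of \<open>L0\<close>, the other is the
  rescaling argument. From here on, membership in the dual is checked by an inequality on one
  neighbourhood of zero.\<close>

lemma dual_iff:
  "f \<in> dual M E P \<longleftrightarrow> l0_functional f \<and>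
     (\<exists>I. gauges M E P I \<and> (\<forall>x\<in>gauge_nbhd M E I (mzero E). AE \<omega> in M. rep (f x) \<omega> \<le> 1))"
proof
  assume "f \<in> dual M E P"
  then have f: "f \<in> extensional (mcarrier E)" "l0_linear M E f" and cont: "continuous_map (Ts M E P) (L0top M) f"
    by (auto simp: dual_def)
  have fL: "f x \<in> L0 M" if "x \<in> mcarrier E" for x
  proof -
    have "f x \<in> topspace (L0top M)" using cont that by (metis continuous_map_image_subset_topspace image_subset_iff topspace_Ts)
    then show ?thesis by (auto simp: L0top_def)
  qed
  have F: "l0_functional f" using f fL by (simp add: l0_functional_def)
  have one: "l0c M 1 \<in> L0pp M" unfolding l0c_def by (rule L0ppI) auto
  let ?U = "{s \<in> L0 M. l0_less M (l0_abs M (l0_diff M s (l0c M 0))) (l0c M 1)}"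
  have "openin (L0top M) ?U" unfolding L0top_def
    by (rule topology_generated_by_Basis) (use one l0c_L0 in blast)
  then have "openin (Ts M E P) {x \<in> topspace (Ts M E P). f x \<in> ?U}" using cont by (rule openin_continuous_map_preimage[rotated])
  moreover have abs: "AE \<omega> in M. rep (l0_abs M (l0_diff M (f x) (l0c M 0))) \<omega> = \<bar>rep (f x) \<omega>\<bar>" if "x \<in> mcarrier E" for x
    using rep_l0_abs[OF l0_diff_L0[OF fL[OF that] l0c_L0[of M 0]]] rep_l0_diff[OF fL[OF that] l0c_L0[of M 0]] rep_l0c[of M 0]
    by eventually_elim simp
  have "AE \<omega> in M. rep (f (mzero E)) \<omega> = 0"
    using functional_smul[OF F l0c_L0[of M 0] zero_closed] rep_l0c[of M 0] unfolding zero_smul[OF zero_closed]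
    by eventually_elim simp
  then have "l0_less M (l0_abs M (l0_diff M (f (mzero E)) (l0c M 0))) (l0c M 1)"
    unfolding l0_less_def using abs[OF zero_closed] rep_l0c[of M 1] by eventually_elim simp
  then have "mzero E \<in> {x \<in> topspace (Ts M E P). f x \<in> ?U}" using zero_closed fL by (simp add: topspace_Ts)
  ultimately obtain I where I: "gauges M E P I" "gauge_nbhd M E I (mzero E) \<subseteq> {x \<in> topspace (Ts M E P). f x \<in> ?U}"
    using open_gauge_nbhd by blast
  have "AE \<omega> in M. rep (f x) \<omega> \<le> 1" if "x \<in> gauge_nbhd M E I (mzero E)" for x
  proof -
    have "x \<in> mcarrier E" "AE \<omega> in M. rep (l0_abs M (l0_diff M (f x) (l0c M 0))) \<omega> < rep (l0c M 1) \<omega>"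
      using that I(2) by (auto simp: topspace_Ts l0_less_def)
    from this(2) abs[OF this(1)] rep_l0c[of M 1] show ?thesis by eventually_elim simp
  qed
  then show "l0_functional f \<and>
     (\<exists>I. gauges M E P I \<and> (\<forall>x\<in>gauge_nbhd M E I (mzero E). AE \<omega> in M. rep (f x) \<omega> \<le> 1))"
    using F I(1) by blast
next
  assume "l0_functional f \<and>
     (\<exists>I. gauges M E P I \<and> (\<forall>x\<in>gauge_nbhd M E I (mzero E). AE \<omega> in M. rep (f x) \<omega> \<le> 1))"
  then show "f \<in> dual M E P" using functional_continuous by (auto simp: dual_def l0_functional_def)
qed

lemma dual_functional: "f \<in> dual M E P \<Longrightarrow> l0_functional f"
  by (simp add: dual_iff)

end

section \<open>The weak topology and the polar\<close>

text \<open>The factor \<open>c\<close> is random because scalar multiplication by a possibly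
  unbounded \<open>r\<close> produces such errors; only countably many null sets are
  discarded.\<close>

lemma AE_le_zeroI:
  fixes h c :: "'a \<Rightarrow> real"
  assumes "\<And>n. AE \<omega> in M. h \<omega> \<le> c \<omega> / real (Suc n)"
  shows "AE \<omega> in M. h \<omega> \<le> 0"
proof -
  have "AE \<omega> in M. \<forall>n. h \<omega> \<le> c \<omega> / real (Suc n)" using assms by (simp only: AE_all_countable) simp
  then show ?thesis
  proof eventually_elim
    case (elim \<omega>)
    have "(\<lambda>n. c \<omega> * inverse (real (Suc n))) \<longlonglongrightarrow> c \<omega> * 0"
      by (intro tendsto_mult tendsto_const LIMSEQ_inverse_real_of_nat)
    then have "(\<lambda>n. c \<omega> / real (Suc n)) \<longlonglongrightarrow> 0" by (simp add: divide_inverse)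
    then show ?case using elim by (intro LIMSEQ_le_const) auto
  qed
qed

context l0_seminormed
begin

abbreviation "dm \<equiv> dual_mod M E P"

lemma mcarrier_dual: "mcarrier dm = dual M E P"
  by (simp add: dual_mod_def)

lemma rep_dual_diff:
  assumes f: "f \<in> dual M E P" and g: "g \<in> dual M E P" and x: "x \<in> mcarrier E"
  shows "mdiff M dm f g x \<in> L0 M" "AE \<omega> in M. rep (mdiff M dm f g x) \<omega> = rep (f x) \<omega> - rep (g x) \<omega>"
proof -
  have fx: "f x \<in> L0 M" and gx: "g x \<in> L0 M" using dual_functional f g functional_L0 x by auto
  note mul = l0_mul_L0[OF l0c_L0[of M "-1"] gx]
  have eq: "mdiff M dm f g x = l0_add M (f x) (l0_mul M (l0c M (-1)) (g x))"
    using x by (simp add: mdiff_def dual_mod_def)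
  show "mdiff M dm f g x \<in> L0 M" unfolding eq by (rule l0_add_L0[OF fx mul])
  show "AE \<omega> in M. rep (mdiff M dm f g x) \<omega> = rep (f x) \<omega> - rep (g x) \<omega>"
    unfolding eq using rep_l0_add[OF fx mul] rep_l0_mul[OF l0c_L0[of M "-1"] gx] rep_l0c[of M "-1"]
    by eventually_elim simp
qed

text \<open>The weak seminorms are evaluated at \<open>f - g\<close>, and \<open>wsn x\<close> is
  \<open>undefined\<close> off the dual. Halving all radii makes each functional at most
  \<open>1 / 2\<close> in absolute value, hence their difference at most \<open>1\<close>.\<close>

lemma dual_diff_closed:
  assumes f: "f \<in> dual M E P" and g: "g \<in> dual M E P"
  shows "mdiff M dm f g \<in> dual M E P"
proof -
  let ?h = "mdiff M dm f g"
  have F: "l0_functional f" and G: "l0_functional g" using f g by (simp_all add: dual_functional)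
  note L = rep_dual_diff(1)[OF f g] and R = rep_dual_diff(2)[OF f g]
  have H: "l0_functional ?h"
  proof (rule functionalI)
    show "?h \<in> extensional (mcarrier E)" by (simp add: mdiff_def dual_mod_def)
    show "?h x \<in> L0 M" if "x \<in> mcarrier E" for x using L that .
    show "AE \<omega> in M. rep (?h (madd E x y)) \<omega> = rep (?h x) \<omega> + rep (?h y) \<omega>"
      if x: "x \<in> mcarrier E" and y: "y \<in> mcarrier E" for x y
      using R[OF x] R[OF y] R[OF add_closed[OF x y]] functional_add[OF F x y] functional_add[OF G x y]
      by eventually_elim simp
    show "AE \<omega> in M. rep (?h (msmul E r x)) \<omega> = rep r \<omega> * rep (?h x) \<omega>"
      if r: "r \<in> L0 M" and x: "x \<in> mcarrier E" for r x
      using R[OF x] R[OF smul_closed[OF r x]] functional_smul[OF F r x] functional_smul[OF G r x]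
      by eventually_elim (simp add: right_diff_distrib)
  qed
  obtain I J where I: "gauges M E P I" "\<And>x. x \<in> gauge_nbhd M E I (mzero E) \<Longrightarrow> AE \<omega> in M. rep (f x) \<omega> \<le> 1"
    and J: "gauges M E P J" "\<And>x. x \<in> gauge_nbhd M E J (mzero E) \<Longrightarrow> AE \<omega> in M. rep (g x) \<omega> \<le> 1"
    using f g unfolding dual_iff by blast
  define half where "half e = cls M (\<lambda>\<omega>. rep e \<omega> / 2)" for e
  have half: "half e \<in> L0pp M" "AE \<omega> in M. rep (half e) \<omega> = rep e \<omega> / 2" if e: "e \<in> L0pp M" for e
  proof -
    have [measurable]: "rep e \<in> borel_measurable M" using rep_measurable[OF L0ppD(1)[OF e]] .
    show "half e \<in> L0pp M" unfolding half_def
    proof (rule L0ppI)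
      show "AE \<omega> in M. 0 < rep e \<omega> / 2" using L0ppD(2)[OF e] by eventually_elim simp
    qed simp
    show "AE \<omega> in M. rep (half e) \<omega> = rep e \<omega> / 2" unfolding half_def by (rule rep_cls(2)) simp
  qed
  define Q where "Q = map_prod id half ` (I \<union> J)"
  have IJ: "gauges M E P (I \<union> J)" using gauges_Un[OF I(1) J(1)] .
  have Q: "gauges M E P Q" unfolding gauges_def
  proof (intro conjI ballI)
    show "finite Q" using gaugesD(1)[OF IJ] by (simp add: Q_def)
    fix Ne assume "Ne \<in> Q"
    then obtain Ne' where Ne': "Ne' \<in> I \<union> J" "Ne = map_prod id half Ne'" unfolding Q_def by (elim imageE)
    obtain N e where "Ne' = (N, e)" by (cases Ne')
    with Ne' have N: "(N, e) \<in> I \<union> J" and Ne: "Ne = (N, half e)" by simp_all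
    show "case Ne of (N, e) \<Rightarrow> stable_finite M E P N \<and> N \<noteq> {} \<and> e \<in> L0pp M"
      using gaugesD(2)[OF IJ N] gaugesD(3)[OF IJ N] half(1)[OF gaugesD(4)[OF IJ N]] by (simp add: Ne)
  qed
  have "AE \<omega> in M. rep (?h y) \<omega> \<le> 1" if y: "y \<in> gauge_nbhd M E Q (mzero E)" for y
  proof -
    have y': "y \<in> mcarrier E" using y by (simp add: gauge_nbhd_def)
    have "msmul E (l0c M 2) y \<in> gauge_nbhd M E (I \<union> J) (mzero E)"
    proof (rule smul_gauge_nbhd_zero[OF IJ l0c_L0 y'])
      fix N e p assume N: "(N, e) \<in> I \<union> J" "p \<in> N"
      have "(N, half e) \<in> Q" unfolding Q_def using N(1) by force
      from gauge_nbhd_zeroD[OF Q y this N(2)] half(2)[OF gaugesD(4)[OF IJ N(1)]] rep_l0c[of M 2]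
      show "AE \<omega> in M. \<bar>rep (l0c M 2) \<omega>\<bar> * rep (p y) \<omega> \<le> rep e \<omega>" by eventually_elim simp
    qed
    then have z: "msmul E (l0c M 2) y \<in> gauge_nbhd M E I (mzero E)" "msmul E (l0c M 2) y \<in> gauge_nbhd M E J (mzero E)"
      by (simp_all add: gauge_nbhd_Un)
    have "AE \<omega> in M. \<bar>rep (f (msmul E (l0c M 2) y)) \<omega>\<bar> \<le> 1" "AE \<omega> in M. \<bar>rep (g (msmul E (l0c M 2) y)) \<omega>\<bar> \<le> 1"
      using functional_abs_le_on_gauge_nbhd[OF F I(1) _ z(1)] I(2) functional_abs_le_on_gauge_nbhd[OF G J(1) _ z(2)] J(2)
      by blast+
    then show ?thesis
      using functional_smul[OF F l0c_L0[of M 2] y'] functional_smul[OF G l0c_L0[of M 2] y'] rep_l0c[of M 2] R[OF y']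
      by eventually_elim (simp add: abs_mult)
  qed
  then show ?thesis unfolding dual_iff using H Q by blast
qed

definition wsn :: "'e \<Rightarrow> ('e \<Rightarrow> 'a L0) \<Rightarrow> 'a L0" where
  "wsn x = (\<lambda>f\<in>dual M E P. l0_abs M (f x))"

lemma weak_fam_eq: "weak_fam M E P = wsn ` mcarrier E"
  unfolding weak_fam_def wsn_def by blast

lemma wsn_L0: "x \<in> mcarrier E \<Longrightarrow> f \<in> dual M E P \<Longrightarrow> wsn x f \<in> L0 M"
  by (simp add: wsn_def l0_abs_L0 functional_L0 dual_functional)

lemma rep_wsn_diff:
  assumes f: "f \<in> dual M E P" and g: "g \<in> dual M E P" and x: "x \<in> mcarrier E"
  shows "AE \<omega> in M. rep (wsn x (mdiff M dm f g)) \<omega> = \<bar>rep (f x) \<omega> - rep (g x) \<omega>\<bar>"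
proof -
  have "wsn x (mdiff M dm f g) = l0_abs M (mdiff M dm f g x)"
    using dual_diff_closed[OF f g] by (simp add: wsn_def)
  then show ?thesis using rep_l0_abs[OF rep_dual_diff(1)[OF f g x]] rep_dual_diff(2)[OF f g x]
    by (auto elim: eventually_elim2)
qed

lemma sigma_s_open_gauge_nbhd:
  assumes "openin (sigma_s M E P) W" "f \<in> W"
  shows "\<exists>I. gauges M dm (weak_fam M E P) I \<and> gauge_nbhd M dm I f \<subseteq> W"
proof (rule Ts_open_gauge_nbhd[OF _ _ assms[unfolded sigma_s_def]])
  fix p f g assume "p \<in> weak_fam M E P" "f \<in> mcarrier dm" "g \<in> mcarrier dm"
  then show "p (mdiff M dm f g) \<in> L0 M"
    by (auto simp: weak_fam_eq mcarrier_dual wsn_L0 dual_diff_closed)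
next
  fix p f g h assume "p \<in> weak_fam M E P" and "f \<in> mcarrier dm" "g \<in> mcarrier dm" "h \<in> mcarrier dm"
  then obtain x where x: "x \<in> mcarrier E" "p = wsn x"
    and f: "f \<in> dual M E P" and g: "g \<in> dual M E P" and h: "h \<in> dual M E P"
    by (auto simp: weak_fam_eq mcarrier_dual)
  show "AE \<omega> in M. rep (p (mdiff M dm f h)) \<omega> \<le> rep (p (mdiff M dm f g)) \<omega> + rep (p (mdiff M dm g h)) \<omega>"
    unfolding x(2) using rep_wsn_diff[OF f h x(1)] rep_wsn_diff[OF f g x(1)] rep_wsn_diff[OF g h x(1)]
    by eventually_elim simp
qed

lemma dual_subset_topspace: "dual M E P \<subseteq> topspace (sigma_s M E P)"
proof
  fix f assume f: "f \<in> dual M E P"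
  \<comment> \<open>Any point of \<open>E\<close> would do; zero is one that is always
    available.\<close>
  let ?p = "wsn (mzero E)"
  have one: "l0c M 1 \<in> L0pp M" unfolding l0c_def by (rule L0ppI) auto
  have "stable_finite M dm (weak_fam M E P) {?p}"
  proof (rule stable_finite_singleton)
    show "?p \<in> weak_fam M E P" unfolding weak_fam_eq using zero_closed by blast
    show "?p \<in> extensional (mcarrier dm)" unfolding wsn_def mcarrier_dual by simp
    show "?p f \<in> L0 M" if "f \<in> mcarrier dm" for f using wsn_L0[OF zero_closed] that by (simp add: mcarrier_dual)
  qed
  then have op: "openin (sigma_s M E P) (sball M dm {?p} f (l0c M 1))"
    unfolding sigma_s_def Ts_def by (intro topology_generated_by_Basis) (use f one mcarrier_dual in blast)
  have "f \<in> sball M dm {?p} f (l0c M 1)"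
  proof (rule sballI[of _ _ _ _ "\<lambda>_. 0"])
    show "p (mdiff M dm f f) \<in> L0 M" if "p \<in> {?p}" for p
      using that f by (simp add: wsn_L0 zero_closed dual_diff_closed)
    show "AE \<omega> in M. rep (p (mdiff M dm f f)) \<omega> \<le> 0" if "p \<in> {?p}" for p
      using rep_wsn_diff[OF f f zero_closed] that by (auto elim: eventually_mono)
  qed (use f L0ppD(2)[OF one] in \<open>auto simp: mcarrier_dual\<close>)
  then show "f \<in> topspace (sigma_s M E P)" using openin_subset[OF op] by blast
qed

text \<open>\<open>m_concat\<close> is a definite description, so existence and uniqueness must both
  be supplied. The candidate \<open>h\<close> is given; it is the only one because the indicators
  determine an element on each piece and the pieces cover the space.\<close>

lemma dual_concat_eqI:
  assumes A: "meas_part M A" and f: "\<And>k. f k \<in> dual M E P" and h: "h \<in> dual M E P"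
    and eq: "\<And>x k. x \<in> mcarrier E \<Longrightarrow> AE \<omega> in M. \<omega> \<in> A k \<longrightarrow> rep (h x) \<omega> = rep (f k x) \<omega>"
  shows "m_concat M dm A f = h"
  unfolding m_concat_def
proof (rule the_equality)
  have ind: "l0_ind M (A k) \<in> L0 M" "AE \<omega> in M. rep (l0_ind M (A k)) \<omega> = indicator (A k) \<omega>" for k
  proof -
    have "(indicator (A k) :: 'a \<Rightarrow> real) \<in> borel_measurable M"
      using A by (intro borel_measurable_indicator) (simp add: meas_part_def)
    then show "l0_ind M (A k) \<in> L0 M" "AE \<omega> in M. rep (l0_ind M (A k)) \<omega> = indicator (A k) \<omega>"
      unfolding l0_ind_def by (rule cls_in_L0, rule rep_cls(2))
  qed
  have "msmul dm (l0_ind M (A k)) h = msmul dm (l0_ind M (A k)) (f k)" for k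
  proof -
    have "l0_mul M (l0_ind M (A k)) (h x) = l0_mul M (l0_ind M (A k)) (f k x)" if x: "x \<in> mcarrier E" for x
      unfolding l0_mul_def
    proof (rule cls_cong)
      show "AE \<omega> in M. rep (l0_ind M (A k)) \<omega> * rep (h x) \<omega> = rep (l0_ind M (A k)) \<omega> * rep (f k x) \<omega>"
        using ind(2)[of k] eq[OF x, of k] by eventually_elim (auto simp: indicator_def)
    qed
    then show ?thesis unfolding dual_mod_def by (auto intro: restrict_ext)
  qed
  then show "h \<in> mcarrier dm \<and> (\<forall>k. msmul dm (l0_ind M (A k)) h = msmul dm (l0_ind M (A k)) (f k))"
    using h by (simp add: mcarrier_dual)
  fix y assume "y \<in> mcarrier dm \<and> (\<forall>k. msmul dm (l0_ind M (A k)) y = msmul dm (l0_ind M (A k)) (f k))"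
  then have y: "y \<in> dual M E P" and yf: "\<And>k. msmul dm (l0_ind M (A k)) y = msmul dm (l0_ind M (A k)) (f k)"
    by (auto simp: mcarrier_dual)
  show "y = h"
  proof (rule extensionalityI[of _ "mcarrier E"])
    show "y \<in> extensional (mcarrier E)" "h \<in> extensional (mcarrier E)" using y h by (auto simp: dual_def)
    fix x assume x: "x \<in> mcarrier E"
    have L: "y x \<in> L0 M" "h x \<in> L0 M" "\<And>k. f k x \<in> L0 M" using y h f x functional_L0 dual_functional by auto
    show "y x = h x"
    proof (rule L0_eqI[OF L(1,2) meas_part_AE[OF A]])
      fix k
      have "l0_mul M (l0_ind M (A k)) (y x) = l0_mul M (l0_ind M (A k)) (f k x)"
        using fun_cong[OF yf[of k], of x] x by (simp add: dual_mod_def)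
      then have "AE \<omega> in M. rep (l0_mul M (l0_ind M (A k)) (f k x)) \<omega> = rep (l0_ind M (A k)) \<omega> * rep (y x) \<omega>"
        using rep_l0_mul[OF ind(1)[of k] L(1)] by simp
      then show "AE \<omega> in M. \<omega> \<in> A k \<longrightarrow> rep (y x) \<omega> = rep (h x) \<omega>"
        using rep_l0_mul[OF ind(1)[of k] L(3)[of k]] ind(2)[of k] eq[OF x, of k]
        by eventually_elim auto
    qed
  qed
qed

section \<open>Pointwise bounds and absorption\<close>

lemma stable_finite_bounded:
  assumes N: "stable_finite M E P N" and x: "x \<in> mcarrier E"
  shows "\<exists>c\<in>borel_measurable M. \<forall>p\<in>N. AE \<omega> in M. rep (p x) \<omega> \<le> c \<omega>"
proof -
  have "\<exists>A Nk. meas_part M A \<and> (\<forall>k. finite (Nk k) \<and> Nk k \<subseteq> P) \<and> (\<forall>p\<in>N. \<forall>x\<in>mcarrier E. \<forall>k.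
    AE \<omega> in M. \<omega> \<in> A k \<longrightarrow> (\<exists>q\<in>Nk k. rep (p x) \<omega> = rep (q x) \<omega>))"
    by (rule stable_finite_attained[OF N]) (rule seminorm_L0(1))
  then obtain A Nk where A: "meas_part M A" and fin: "\<forall>k. finite (Nk k) \<and> Nk k \<subseteq> P"
    and all: "\<forall>p\<in>N. \<forall>x\<in>mcarrier E. \<forall>k.
      AE \<omega> in M. \<omega> \<in> A k \<longrightarrow> (\<exists>q\<in>Nk k. rep (p x) \<omega> = rep (q x) \<omega>)" by (elim exE conjE)
  have Nk: "\<And>k. finite (Nk k)" "\<And>k. Nk k \<subseteq> P" using fin by auto
  have att: "AE \<omega> in M. \<omega> \<in> A k \<longrightarrow> (\<exists>q\<in>Nk k. rep (p x) \<omega> = rep (q x) \<omega>)"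
    if "p \<in> N" "x \<in> mcarrier E" for p x k using all that by blast
  \<comment> \<open>The sum of absolute values dominates whichever of the finitely many
    \<open>q\<close> applies at a given point; the functions \<open>c k\<close> are then glued along
    \<open>A\<close>.\<close>
  define c where "c k \<omega> = (\<Sum>q\<in>Nk k. \<bar>rep (q x) \<omega>\<bar>)" for k \<omega>
  have "c k \<in> borel_measurable M" for k unfolding c_def
    using Nk(2) seminorm_L0(1)[OF _ x] by (intro borel_measurable_sum borel_measurable_abs rep_measurable) blast
  then have "(\<lambda>\<omega>. c (THE k. \<omega> \<in> A k) \<omega>) \<in> borel_measurable M" by (rule meas_part_glue_measurable[OF A])
  moreover have "AE \<omega> in M. rep (p x) \<omega> \<le> c (THE k. \<omega> \<in> A k) \<omega>" if p: "p \<in> N" for p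
  proof (rule meas_part_AE[OF A])
    fix k show "AE \<omega> in M. \<omega> \<in> A k \<longrightarrow> rep (p x) \<omega> \<le> c (THE k. \<omega> \<in> A k) \<omega>"
      using att[OF p x, of k]
    proof (eventually_elim, intro impI)
      fix \<omega> assume "\<omega> \<in> A k" "\<omega> \<in> A k \<longrightarrow> (\<exists>q\<in>Nk k. rep (p x) \<omega> = rep (q x) \<omega>)"
      then obtain q where q: "q \<in> Nk k" "rep (p x) \<omega> = rep (q x) \<omega>" by blast
      have "\<bar>rep (q x) \<omega>\<bar> \<le> c k \<omega>" unfolding c_def using q(1) Nk(1) by (intro member_le_sum) auto
      then show "rep (p x) \<omega> \<le> c (THE k. \<omega> \<in> A k) \<omega>" using meas_part_index[OF A \<open>\<omega> \<in> A k\<close>] q(2) by simp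
    qed
  qed
  ultimately show ?thesis by (intro bexI[rotated] ballI)
qed

text \<open>Finiteness of \<open>I\<close> permits taking minima, and each stable finite family has
  a measurable bound at \<open>x\<close>. The absorbing factor \<open>d\<close> is random; in
  general no constant will do.\<close>

lemma gauges_absorbing:
  assumes I: "gauges M E P I" and x: "x \<in> mcarrier E"
  shows "\<exists>d\<in>borel_measurable M. (AE \<omega> in M. d \<omega> > 0) \<and>
    (\<forall>(N, e)\<in>I. \<forall>p\<in>N. AE \<omega> in M. d \<omega> * rep (p x) \<omega> \<le> rep e \<omega>)"
proof -
  have "finite I" using gaugesD(1)[OF I] .
  then show ?thesis using I
  proof induction
    case empty
    show ?case by (intro bexI[of _ "\<lambda>_. 1"]) auto
  next
    case (insert Ne I)
    obtain N e where Ne: "Ne = (N, e)" by (cases Ne)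
    have I: "gauges M E P I" and N: "stable_finite M E P N" and e: "e \<in> L0pp M"
      using insert.prems by (auto simp: gauges_def Ne)
    obtain d where d[measurable]: "d \<in> borel_measurable M" and d_pos: "AE \<omega> in M. d \<omega> > 0"
      and dI: "\<forall>(N, e)\<in>I. \<forall>p\<in>N. AE \<omega> in M. d \<omega> * rep (p x) \<omega> \<le> rep e \<omega>"
      using insert.IH[OF I] by blast
    obtain c where c[measurable]: "c \<in> borel_measurable M" and cN: "\<forall>p\<in>N. AE \<omega> in M. rep (p x) \<omega> \<le> c \<omega>"
      using stable_finite_bounded[OF N x] by blast
    have [measurable]: "rep e \<in> borel_measurable M" using rep_measurable[OF L0ppD(1)[OF e]] .
    \<comment> \<open>\<open>1 + \<bar>c\<bar>\<close> bounds \<open>p x\<close> for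
      \<open>p \<in> N\<close> and never vanishes, so the new factor is positive and scales
      \<open>p x\<close> below \<open>e\<close>.\<close>
    let ?d = "\<lambda>\<omega>. min (d \<omega>) (rep e \<omega> / (1 + \<bar>c \<omega>\<bar>))"
    show ?case
    proof (intro bexI[of _ ?d] conjI ballI)
      show "AE \<omega> in M. ?d \<omega> > 0" using d_pos L0ppD(2)[OF e] by eventually_elim (simp add: divide_pos_pos)
      fix Ne' assume Ne': "Ne' \<in> insert Ne I"
      obtain N' e' where eq: "Ne' = (N', e')" by (cases Ne')
      have "AE \<omega> in M. ?d \<omega> * rep (p x) \<omega> \<le> rep e' \<omega>" if p: "p \<in> N'" for p
      proof -
        have nonneg: "AE \<omega> in M. rep (p x) \<omega> \<ge> 0"
          using gaugesD(5)[OF insert.prems, of N' e' p] Ne' p eq seminorm_L0(2) x by blast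
        consider "(N', e') \<in> I" | "N' = N" "e' = e" using Ne' eq Ne by auto
        then show ?thesis
        proof cases
          case 1
          then have "AE \<omega> in M. d \<omega> * rep (p x) \<omega> \<le> rep e' \<omega>" using dI p by blast
          with nonneg show ?thesis
          proof eventually_elim
            case (elim \<omega>)
            have "?d \<omega> * rep (p x) \<omega> \<le> d \<omega> * rep (p x) \<omega>" using elim(1) by (intro mult_right_mono) auto
            then show ?case using elim(2) by linarith
          qed
        next
          case 2
          then have "AE \<omega> in M. rep (p x) \<omega> \<le> c \<omega>" using cN p by blast
          with nonneg L0ppD(2)[OF e] show ?thesis
          proof eventually_elim
            case (elim \<omega>)
            have "?d \<omega> * rep (p x) \<omega> \<le> rep e \<omega> / (1 + \<bar>c \<omega>\<bar>) * (1 + \<bar>c \<omega>\<bar>)"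
              using elim by (intro mult_mono) auto
            also have "\<dots> = rep e \<omega>" by simp
            finally show ?case using 2 by simp
          qed
        qed
      qed
      then show "case Ne' of (N, e) \<Rightarrow> \<forall>p\<in>N. AE \<omega> in M. ?d \<omega> * rep (p x) \<omega> \<le> rep e \<omega>" by (simp add: eq)
    qed measurable
  qed
qed

end

section \<open>The polar and its limit functionals\<close>

locale l0_polar = l0_seminormed M E P for M :: "'a measure" and E :: "('a, 'e) l0mod" and P +
  fixes U :: "'e set"
  assumes nbhd: "neighbourhood (Ts M E P) (mzero E) U"
begin

abbreviation "K \<equiv> polar M E P U"

lemma U_carrier: "U \<subseteq> mcarrier E"
  using nbhd by (simp add: neighbourhood_def topspace_Ts)

lemma U_gauge_nbhd: "\<exists>I. gauges M E P I \<and> gauge_nbhd M E I (mzero E) \<subseteq> U"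
  using nbhd open_gauge_nbhd unfolding neighbourhood_def by (meson order_trans)

text \<open>This is what makes concatenations and pointwise limits manageable: for both it remains
  to check linearity and one inequality, with no continuity argument.\<close>

lemma polar_iff: "f \<in> K \<longleftrightarrow> l0_functional f \<and> (\<forall>x\<in>U. AE \<omega> in M. rep (f x) \<omega> \<le> 1)"
proof -
  have "l0_le M (f x) (l0c M 1) \<longleftrightarrow> (AE \<omega> in M. rep (f x) \<omega> \<le> 1)" for x
    unfolding l0_le_def by (rule eventually_subst) (use rep_l0c[of M 1] in \<open>eventually_elim, simp\<close>)
  then have "f \<in> K \<longleftrightarrow> f \<in> dual M E P \<and> (\<forall>x\<in>U. AE \<omega> in M. rep (f x) \<omega> \<le> 1)" by (simp add: polar_def)
  then show ?thesis using U_gauge_nbhd unfolding dual_iff by blast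
qed

lemma polar_dual: "f \<in> K \<Longrightarrow> f \<in> dual M E P"
  by (simp add: polar_def)

lemma polar_functional: "f \<in> K \<Longrightarrow> l0_functional f"
  by (simp add: polar_iff)

text \<open>The concatenation is built pointwise in \<open>L0\<close>, where it always exists, and
  is then recognised as \<open>m_concat\<close> by uniqueness.\<close>

lemma polar_concat:
  assumes A: "meas_part M A" and f: "\<And>k. f k \<in> K"
  shows "m_concat M dm A f \<in> K"
    and "x \<in> mcarrier E \<Longrightarrow> AE \<omega> in M. \<omega> \<in> A k \<longrightarrow> rep (m_concat M dm A f x) \<omega> = rep (f k x) \<omega>"
proof -
  define h where "h = (\<lambda>x\<in>mcarrier E. l0_concat M A (\<lambda>k. f k x))"
  have F: "l0_functional (f k)" for k using polar_functional[OF f] .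
  have L: "f k x \<in> L0 M" if "x \<in> mcarrier E" for k x using functional_L0[OF F that] .
  have hL: "h x \<in> L0 M" if "x \<in> mcarrier E" for x
    using l0_concat_L0[of M A "\<lambda>k. f k x", OF A L[OF that]] that by (simp add: h_def)
  have hr: "AE \<omega> in M. \<omega> \<in> A k \<longrightarrow> rep (h x) \<omega> = rep (f k x) \<omega>" if "x \<in> mcarrier E" for x k
    using rep_l0_concat[of M A "\<lambda>k. f k x", OF A L[OF that]] that by (simp add: h_def)
  have "h \<in> K" unfolding polar_iff
  proof (intro conjI ballI functionalI hL)
    show "h \<in> extensional (mcarrier E)" by (simp add: h_def)
    show "AE \<omega> in M. rep (h (madd E x y)) \<omega> = rep (h x) \<omega> + rep (h y) \<omega>"
      if x: "x \<in> mcarrier E" and y: "y \<in> mcarrier E" for x y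
    proof (rule meas_part_AE[OF A])
      fix k show "AE \<omega> in M. \<omega> \<in> A k \<longrightarrow> rep (h (madd E x y)) \<omega> = rep (h x) \<omega> + rep (h y) \<omega>"
        using hr[OF x, of k] hr[OF y, of k] hr[OF add_closed[OF x y], of k] functional_add[OF F x y, of k]
        by eventually_elim auto
    qed
    show "AE \<omega> in M. rep (h (msmul E r x)) \<omega> = rep r \<omega> * rep (h x) \<omega>"
      if r: "r \<in> L0 M" and x: "x \<in> mcarrier E" for r x
    proof (rule meas_part_AE[OF A])
      fix k show "AE \<omega> in M. \<omega> \<in> A k \<longrightarrow> rep (h (msmul E r x)) \<omega> = rep r \<omega> * rep (h x) \<omega>"
        using hr[OF x, of k] hr[OF smul_closed[OF r x], of k] functional_smul[OF F r x, of k]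
        by eventually_elim auto
    qed
    fix x assume x: "x \<in> U"
    show "AE \<omega> in M. rep (h x) \<omega> \<le> 1"
    proof (rule meas_part_AE[OF A])
      fix k
      have "AE \<omega> in M. rep (f k x) \<omega> \<le> 1" using f[of k] x by (simp add: polar_iff)
      moreover have "AE \<omega> in M. \<omega> \<in> A k \<longrightarrow> rep (h x) \<omega> = rep (f k x) \<omega>" using hr x U_carrier by blast
      ultimately show "AE \<omega> in M. \<omega> \<in> A k \<longrightarrow> rep (h x) \<omega> \<le> 1" by eventually_elim auto
    qed
  qed
  moreover have "m_concat M dm A f = h"
    using polar_dual[OF f] polar_dual[OF \<open>h \<in> K\<close>] hr by (intro dual_concat_eqI A)
  ultimately show "m_concat M dm A f \<in> K"
    and "x \<in> mcarrier E \<Longrightarrow> AE \<omega> in M. \<omega> \<in> A k \<longrightarrow> rep (m_concat M dm A f x) \<omega> = rep (f k x) \<omega>"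
    using hr by auto
qed

text \<open>If \<open>d x\<close> lies in a gauge neighbourhood inside \<open>U\<close>, linearity
  gives \<open>d * \<bar>f x\<bar> \<le> 1\<close>, and \<open>1 / d\<close> does not depend on
  \<open>f\<close>.\<close>

lemma polar_bounded:
  assumes x: "x \<in> mcarrier E"
  shows "\<exists>c\<in>borel_measurable M. \<forall>f\<in>K. AE \<omega> in M. \<bar>rep (f x) \<omega>\<bar> \<le> c \<omega>"
proof -
  obtain I where I: "gauges M E P I" "gauge_nbhd M E I (mzero E) \<subseteq> U" using U_gauge_nbhd by blast
  obtain d where d: "d \<in> borel_measurable M" and d_pos: "AE \<omega> in M. d \<omega> > 0"
    and dI: "\<forall>(N, e)\<in>I. \<forall>p\<in>N. AE \<omega> in M. d \<omega> * rep (p x) \<omega> \<le> rep e \<omega>"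
    using gauges_absorbing[OF I(1) x] by blast
  note D = cls_in_L0[OF d]
  have dx: "msmul E (cls M d) x \<in> gauge_nbhd M E I (mzero E)"
  proof (rule smul_gauge_nbhd_zero[OF I(1) D x])
    fix N e p assume "(N, e) \<in> I" "p \<in> N"
    then have "AE \<omega> in M. d \<omega> * rep (p x) \<omega> \<le> rep e \<omega>" using dI by blast
    then show "AE \<omega> in M. \<bar>rep (cls M d) \<omega>\<bar> * rep (p x) \<omega> \<le> rep e \<omega>"
      using rep_cls(2)[OF d] d_pos by eventually_elim simp
  qed
  have "AE \<omega> in M. \<bar>rep (f x) \<omega>\<bar> \<le> 1 / d \<omega>" if f: "f \<in> K" for f
  proof -
    have "AE \<omega> in M. \<bar>rep (f (msmul E (cls M d) x)) \<omega>\<bar> \<le> 1"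
      using functional_abs_le_on_gauge_nbhd[OF polar_functional[OF f] I(1) _ dx] f I(2) unfolding polar_iff by blast
    then show ?thesis using functional_smul[OF polar_functional[OF f] D x] rep_cls(2)[OF d] d_pos
      by eventually_elim (simp add: abs_mult field_simps)
  qed
  moreover have "(\<lambda>\<omega>. 1 / d \<omega>) \<in> borel_measurable M" using d by measurable
  ultimately show ?thesis by (intro bexI[rotated] ballI)
qed

sublocale cs: concat_space M K "mcarrier E" "\<lambda>f x. rep (f x)" "m_concat M dm"
proof
  show "rep (f x) \<in> borel_measurable M" if "f \<in> K" "x \<in> mcarrier E" for f x
    using rep_measurable[OF functional_L0[OF polar_functional]] that by blast
  show "m_concat M dm A f \<in> K" if "meas_part M A" "\<And>k. f k \<in> K" for A f
    using polar_concat(1) that by blast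
  show "AE \<omega> in M. \<omega> \<in> A k \<longrightarrow> rep (m_concat M dm A f x) \<omega> = rep (f k x) \<omega>"
    if "meas_part M A" "\<And>k. f k \<in> K" "x \<in> mcarrier E" for A f x k
    using polar_concat(2) that by blast
  show "f = g" if f: "f \<in> K" and g: "g \<in> K" and eq: "\<And>x. x \<in> mcarrier E \<Longrightarrow> AE \<omega> in M. rep (f x) \<omega> = rep (g x) \<omega>" for f g
  proof (rule extensionalityI[of _ "mcarrier E"])
    show "f \<in> extensional (mcarrier E)" "g \<in> extensional (mcarrier E)"
      using polar_functional f g by (auto simp: l0_functional_def)
    show "f x = g x" if x: "x \<in> mcarrier E" for x
      using functional_L0[OF polar_functional] f g x eq by (intro L0_eqI) auto
  qed
  show "\<exists>c\<in>borel_measurable M. \<forall>f\<in>K. AE \<omega> in M. \<bar>rep (f x) \<omega>\<bar> \<le> c \<omega>" if "x \<in> mcarrier E" for x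
    using polar_bounded[OF that] .
qed

lemma stable_filter_cluster_point:
  assumes F: "stable_filter M dm K F"
  shows "\<exists>g\<in>K. cluster_point (sigma_s M E P) F g"
proof -
  have filt: "filter_on K F" using F by (simp add: stable_filter_def)
  obtain B where B: "B \<subseteq> F" "\<And>V. V \<in> F \<Longrightarrow> \<exists>b\<in>B. b \<subseteq> V" "\<And>b. b \<in> B \<Longrightarrow> stable_set M dm b" "stable_coll M dm B"
    using F unfolding stable_filter_def by blast
  have BK: "b \<subseteq> K" "b \<noteq> {}" if "b \<in> B" for b using filt B(1) that unfolding filter_on_def by blast+
  have base: "cs.stab_base B" unfolding cs.stab_base_def
  proof (intro conjI ballI allI impI)
    show "cs.stab b" if "b \<in> B" for b using BK(1)[OF that] B(3)[OF that] by (simp add: cs.stab_def stable_set_def)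
    show "b \<noteq> {}" if "b \<in> B" for b using BK(2)[OF that] .
    show "\<exists>d\<in>B. d \<subseteq> b \<inter> c" if b: "b \<in> B" "c \<in> B" for b c
    proof -
      have "b \<inter> c \<in> F" using filt b B(1) unfolding filter_on_def by blast
      then show ?thesis using B(2) by blast
    qed
    show "cs.sc A b \<in> B" if "meas_part M A \<and> (\<forall>k. b k \<in> B)" for A b
      using B(4) that unfolding stable_coll_def set_concat_def cs.sc_def by blast
  qed
  have "B \<noteq> {}" using filt B(2) unfolding filter_on_def by blast
  obtain H l where H: "cs.stab_base H" and BH: "B \<subseteq> H"
    and conv: "\<forall>x\<in>mcarrier E. l x \<in> borel_measurable M \<and> (\<forall>e\<in>borel_measurable M. (AE \<omega> in M. e \<omega> > 0) \<longrightarrow>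
      (\<exists>d\<in>H. \<forall>f\<in>d. AE \<omega> in M. \<bar>rep (f x) \<omega> - l x \<omega>\<bar> \<le> e \<omega>))"
    using cs.stab_base_refine_convergent[OF base \<open>B \<noteq> {}\<close>] by (elim exE conjE)
  have l: "l x \<in> borel_measurable M" if "x \<in> mcarrier E" for x using conv that by blast
  have lim: "\<exists>d\<in>H. \<forall>f\<in>d. AE \<omega> in M. \<bar>rep (f x) \<omega> - l x \<omega>\<bar> \<le> e \<omega>"
    if "x \<in> mcarrier E" "e \<in> borel_measurable M" "AE \<omega> in M. e \<omega> > 0" for x e
    using conv that by blast
  note HD = cs.stab_baseD[OF H]
  have HK: "f \<in> K" if "d \<in> H" "f \<in> d" for d f using cs.stab_subset[OF HD(1)[OF that(1)]] that(2) by blast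
  \<comment> \<open>Directedness of \<open>H\<close> handles finitely many points by one member. It
    does not reach infinite sets of points, which is why stable finite families are treated piece by
    piece below.\<close>
  have lim_finite: "\<exists>d\<in>H. \<forall>f\<in>d. \<forall>x\<in>X. AE \<omega> in M. \<bar>rep (f x) \<omega> - l x \<omega>\<bar> \<le> e \<omega>"
    if "finite X" "X \<subseteq> mcarrier E" and e: "e \<in> borel_measurable M" "AE \<omega> in M. e \<omega> > 0" for X e
    using that(1,2)
  proof induction
    case empty
    then show ?case using \<open>B \<noteq> {}\<close> BH by blast
  next
    case (insert x X)
    then obtain d where d: "d \<in> H" "\<forall>f\<in>d. \<forall>x\<in>X. AE \<omega> in M. \<bar>rep (f x) \<omega> - l x \<omega>\<bar> \<le> e \<omega>" by auto
    obtain d' where d': "d' \<in> H" "\<forall>f\<in>d'. AE \<omega> in M. \<bar>rep (f x) \<omega> - l x \<omega>\<bar> \<le> e \<omega>"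
      using lim[OF _ e, of x] insert.prems by blast
    obtain d'' where "d'' \<in> H" "d'' \<subseteq> d \<inter> d'" using HD(3)[OF d(1) d'(1)] by blast
    then show ?case using d(2) d'(2) by (intro bexI[of _ d'']) auto
  qed
  \<comment> \<open>A single element of \<open>K\<close> that is close to \<open>l\<close> at
    several points at once transfers a relation between its values there to the limit.\<close>
  have approx: "\<exists>f\<in>K. \<forall>x\<in>X. AE \<omega> in M. \<bar>rep (f x) \<omega> - l x \<omega>\<bar> \<le> 1 / real (Suc n)"
    if X: "finite X" "X \<subseteq> mcarrier E" for X n
  proof -
    obtain d where d: "d \<in> H" "\<forall>f\<in>d. \<forall>x\<in>X. AE \<omega> in M. \<bar>rep (f x) \<omega> - l x \<omega>\<bar> \<le> 1 / real (Suc n)"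
      using lim_finite[OF X, of "\<lambda>_. 1 / real (Suc n)"] by auto
    then obtain f where "f \<in> d" using HD(2) by blast
    then show ?thesis using d HK by blast
  qed
  define g where "g = (\<lambda>x\<in>mcarrier E. cls M (l x))"
  have gL: "g x \<in> L0 M" "AE \<omega> in M. rep (g x) \<omega> = l x \<omega>" if "x \<in> mcarrier E" for x
    using cls_in_L0[OF l[OF that]] rep_cls(2)[OF l[OF that]] that by (simp_all add: g_def)
  have gK: "g \<in> K" unfolding polar_iff
  proof (intro conjI ballI functionalI gL(1))
    show "g \<in> extensional (mcarrier E)" by (simp add: g_def)
    show "AE \<omega> in M. rep (g (madd E x y)) \<omega> = rep (g x) \<omega> + rep (g y) \<omega>"
      if x: "x \<in> mcarrier E" and y: "y \<in> mcarrier E" for x y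
    proof -
      note xy = add_closed[OF x y]
      \<comment> \<open>Three approximation errors, at \<open>x\<close>, at \<open>y\<close> and at
        their sum.\<close>
      have "AE \<omega> in M. \<bar>l (madd E x y) \<omega> - (l x \<omega> + l y \<omega>)\<bar> \<le> 3 / real (Suc n)" for n
      proof -
        obtain f where f: "f \<in> K" and "\<forall>z\<in>{x, y, madd E x y}. AE \<omega> in M. \<bar>rep (f z) \<omega> - l z \<omega>\<bar> \<le> 1 / real (Suc n)"
          using approx[of "{x, y, madd E x y}" n] x y xy by auto
        then have "AE \<omega> in M. \<bar>rep (f x) \<omega> - l x \<omega>\<bar> \<le> 1 / real (Suc n)" "AE \<omega> in M. \<bar>rep (f y) \<omega> - l y \<omega>\<bar> \<le> 1 / real (Suc n)"
          "AE \<omega> in M. \<bar>rep (f (madd E x y)) \<omega> - l (madd E x y) \<omega>\<bar> \<le> 1 / real (Suc n)" by auto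
        then show ?thesis using functional_add[OF polar_functional[OF f] x y]
        proof eventually_elim
          case (elim \<omega>)
          have "3 / real (Suc n) = 1 / real (Suc n) + 1 / real (Suc n) + 1 / real (Suc n)" by simp
          then show ?case using elim by linarith
        qed
      qed
      then have "AE \<omega> in M. \<bar>l (madd E x y) \<omega> - (l x \<omega> + l y \<omega>)\<bar> \<le> 0" by (rule AE_le_zeroI)
      then show ?thesis using gL(2)[OF x] gL(2)[OF y] gL(2)[OF xy] by eventually_elim simp
    qed
    show "AE \<omega> in M. rep (g (msmul E r x)) \<omega> = rep r \<omega> * rep (g x) \<omega>"
      if r: "r \<in> L0 M" and x: "x \<in> mcarrier E" for r x
    proof -
      note rx = smul_closed[OF r x]
      \<comment> \<open>The error at \<open>x\<close> is multiplied by \<open>r\<close>, whence the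
        random factor \<open>1 + \<bar>r\<bar>\<close>.\<close>
      have "AE \<omega> in M. \<bar>l (msmul E r x) \<omega> - rep r \<omega> * l x \<omega>\<bar> \<le> (1 + \<bar>rep r \<omega>\<bar>) / real (Suc n)" for n
      proof -
        obtain f where f: "f \<in> K" and "\<forall>z\<in>{x, msmul E r x}. AE \<omega> in M. \<bar>rep (f z) \<omega> - l z \<omega>\<bar> \<le> 1 / real (Suc n)"
          using approx[of "{x, msmul E r x}" n] x rx by auto
        then have "AE \<omega> in M. \<bar>rep (f x) \<omega> - l x \<omega>\<bar> \<le> 1 / real (Suc n)"
          "AE \<omega> in M. \<bar>rep (f (msmul E r x)) \<omega> - l (msmul E r x) \<omega>\<bar> \<le> 1 / real (Suc n)" by auto
        then show ?thesis using functional_smul[OF polar_functional[OF f] r x]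
        proof eventually_elim
          case (elim \<omega>)
          have "\<bar>rep r \<omega> * (rep (f x) \<omega> - l x \<omega>)\<bar> \<le> \<bar>rep r \<omega>\<bar> * (1 / real (Suc n))"
            unfolding abs_mult using elim(1) by (intro mult_left_mono) auto
          moreover have "(1 + \<bar>rep r \<omega>\<bar>) / real (Suc n) = 1 / real (Suc n) + \<bar>rep r \<omega>\<bar> * (1 / real (Suc n))"
            by (simp add: add_divide_distrib)
          ultimately show ?case using elim(2,3) by (simp add: right_diff_distrib)
        qed
      qed
      then have "AE \<omega> in M. \<bar>l (msmul E r x) \<omega> - rep r \<omega> * l x \<omega>\<bar> \<le> 0" by (rule AE_le_zeroI)
      then show ?thesis using gL(2)[OF x] gL(2)[OF rx] by eventually_elim simp
    qed
    fix x assume xU: "x \<in> U"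
    then have x: "x \<in> mcarrier E" using U_carrier by blast
    have "AE \<omega> in M. l x \<omega> - 1 \<le> 1 / real (Suc n)" for n
    proof -
      obtain f where f: "f \<in> K" and fx: "AE \<omega> in M. \<bar>rep (f x) \<omega> - l x \<omega>\<bar> \<le> 1 / real (Suc n)"
        using approx[of "{x}" n] x by auto
      have "AE \<omega> in M. rep (f x) \<omega> \<le> 1" using f xU by (simp add: polar_iff)
      with fx show ?thesis by eventually_elim linarith
    qed
    then have "AE \<omega> in M. l x \<omega> - 1 \<le> 0" by (rule AE_le_zeroI)
    then show "AE \<omega> in M. rep (g x) \<omega> \<le> 1" using gL(2)[OF x] by eventually_elim simp
  qed
  note gD = polar_dual[OF gK]
  \<comment> \<open>\<open>N\<close> may represent infinitely many points of \<open>E\<close>, but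
    each piece \<open>A k\<close> involves only a finite set \<open>X k\<close> and hence one member
    \<open>d k\<close>. Concatenating the \<open>d k\<close> along the same partition stays in
    \<open>H\<close>.\<close>
  have near: "\<exists>d\<in>H. \<forall>f\<in>d. \<forall>p\<in>N. AE \<omega> in M. rep (p (mdiff M dm g f)) \<omega> \<le> rep e \<omega>"
    if N: "stable_finite M dm (weak_fam M E P) N" and e: "e \<in> L0pp M" for N e
  proof -
    have wL: "p f \<in> L0 M" if "p \<in> weak_fam M E P" "f \<in> mcarrier dm" for p f
      using that by (auto simp: weak_fam_eq mcarrier_dual wsn_L0)
    have "\<exists>A Nk. meas_part M A \<and> (\<forall>k. finite (Nk k) \<and> Nk k \<subseteq> weak_fam M E P) \<and> (\<forall>p\<in>N. \<forall>f\<in>mcarrier dm. \<forall>k.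
      AE \<omega> in M. \<omega> \<in> A k \<longrightarrow> (\<exists>q\<in>Nk k. rep (p f) \<omega> = rep (q f) \<omega>))"
      by (rule stable_finite_attained[OF N]) (rule wL)
    then obtain A Nk where A: "meas_part M A" and fin: "\<forall>k. finite (Nk k) \<and> Nk k \<subseteq> weak_fam M E P"
      and all: "\<forall>p\<in>N. \<forall>f\<in>mcarrier dm. \<forall>k.
        AE \<omega> in M. \<omega> \<in> A k \<longrightarrow> (\<exists>q\<in>Nk k. rep (p f) \<omega> = rep (q f) \<omega>)" by (elim exE conjE)
    have Nk: "\<And>k. finite (Nk k)" "\<And>k. Nk k \<subseteq> weak_fam M E P" using fin by auto
    have att: "AE \<omega> in M. \<omega> \<in> A k \<longrightarrow> (\<exists>q\<in>Nk k. rep (p f) \<omega> = rep (q f) \<omega>)"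
      if "p \<in> N" "f \<in> mcarrier dm" for p f k using all that by blast
    have "\<exists>X. finite X \<and> X \<subseteq> mcarrier E \<and> Nk k = wsn ` X" for k
      using finite_subset_image[OF Nk(1)[of k] Nk(2)[of k, unfolded weak_fam_eq]] by blast
    then obtain X where X: "\<And>k. finite (X k)" "\<And>k. X k \<subseteq> mcarrier E" "\<And>k. Nk k = wsn ` X k" by metis
    have "\<exists>d\<in>H. \<forall>f\<in>d. \<forall>x\<in>X k. AE \<omega> in M. \<bar>rep (f x) \<omega> - l x \<omega>\<bar> \<le> rep e \<omega>" for k
      using lim_finite[OF X(1,2) rep_measurable[OF L0ppD(1)[OF e]] L0ppD(2)[OF e]] .
    then obtain d where d: "\<And>k. d k \<in> H"
      "\<And>k f x. f \<in> d k \<Longrightarrow> x \<in> X k \<Longrightarrow> AE \<omega> in M. \<bar>rep (f x) \<omega> - l x \<omega>\<bar> \<le> rep e \<omega>" by metis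
    have "AE \<omega> in M. rep (p (mdiff M dm g f)) \<omega> \<le> rep e \<omega>" if f: "f \<in> cs.sc A d" and p: "p \<in> N" for f p
    proof -
      obtain h where h: "f = m_concat M dm A h" "\<And>k. h k \<in> d k" using f by (auto simp: cs.sc_def)
      have hK: "h k \<in> K" for k using HK[OF d(1) h(2)] .
      have fK: "f \<in> K" unfolding h(1) using polar_concat(1)[of A h, OF A hK] .
      note fD = polar_dual[OF fK]
      show ?thesis
      proof (rule meas_part_AE[OF A])
        fix k
        have "AE \<omega> in M. \<omega> \<in> A k \<longrightarrow> rep (q (mdiff M dm g f)) \<omega> \<le> rep e \<omega>" if "q \<in> Nk k" for q
        proof -
          obtain x where x: "x \<in> X k" "q = wsn x" using \<open>q \<in> Nk k\<close> X(3) by blast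
          then have xE: "x \<in> mcarrier E" using X(2) by blast
          show ?thesis unfolding x(2)
            using rep_wsn_diff[OF gD fD xE] polar_concat(2)[of A h x k, OF A hK xE, folded h(1)]
              d(2)[OF h(2) x(1)] gL(2)[OF xE]
            by eventually_elim (auto simp: abs_minus_commute)
        qed
        \<comment> \<open>The seminorm \<open>q\<close> that represents \<open>p\<close> depends on
          the point, so the estimate must hold for all \<open>q\<close> off one null set; finiteness
          of \<open>Nk k\<close> allows this.\<close>
        then have "AE \<omega> in M. \<forall>q\<in>Nk k. \<omega> \<in> A k \<longrightarrow> rep (q (mdiff M dm g f)) \<omega> \<le> rep e \<omega>"
          unfolding AE_finite_all[OF Nk(1)[of k]] by blast
        moreover have "mdiff M dm g f \<in> mcarrier dm" using dual_diff_closed[OF gD fD] by (simp add: mcarrier_dual)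
        ultimately show "AE \<omega> in M. \<omega> \<in> A k \<longrightarrow> rep (p (mdiff M dm g f)) \<omega> \<le> rep e \<omega>"
          using att[OF p, of "mdiff M dm g f" k] by (auto elim: eventually_elim2)
      qed
    qed
    then show ?thesis using HD(4)[of A d, OF A d(1)] by blast
  qed
  have "g \<in> (sigma_s M E P) closure_of V" if V: "V \<in> F" for V
    unfolding in_closure_of
  proof (intro conjI allI impI)
    show "g \<in> topspace (sigma_s M E P)" using dual_subset_topspace gD by blast
    fix T assume T: "g \<in> T \<and> openin (sigma_s M E P) T"
    then obtain I where I: "gauges M dm (weak_fam M E P) I" "gauge_nbhd M dm I g \<subseteq> T"
      using sigma_s_open_gauge_nbhd by blast
    obtain b where b: "b \<in> B" "b \<subseteq> V" using B(2)[OF V] by blast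
    have "finite I" using gaugesD(1)[OF I(1)] .
    \<comment> \<open>The induction starts from \<open>b\<close> itself, a member of
      \<open>H\<close>; staying below \<open>b\<close> keeps the element found inside
      \<open>V\<close>.\<close>
    then have "\<exists>d\<in>H. d \<subseteq> b \<and> (\<forall>f\<in>d. \<forall>(N, e)\<in>I. \<forall>p\<in>N. AE \<omega> in M. rep (p (mdiff M dm g f)) \<omega> \<le> rep e \<omega>)"
      using I(1)
    proof induction
      case empty
      then show ?case using b(1) BH by blast
    next
      case (insert Ne I)
      obtain N e where Ne: "Ne = (N, e)" by (cases Ne)
      have I: "gauges M dm (weak_fam M E P) I" and N: "stable_finite M dm (weak_fam M E P) N" "e \<in> L0pp M"
        using insert.prems by (auto simp: gauges_def Ne)
      obtain d where d: "d \<in> H" "d \<subseteq> b" "\<forall>f\<in>d. \<forall>(N, e)\<in>I. \<forall>p\<in>N. AE \<omega> in M. rep (p (mdiff M dm g f)) \<omega> \<le> rep e \<omega>"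
        using insert.IH[OF I] by blast
      obtain d' where d': "d' \<in> H" "\<forall>f\<in>d'. \<forall>p\<in>N. AE \<omega> in M. rep (p (mdiff M dm g f)) \<omega> \<le> rep e \<omega>"
        using near[OF N] by blast
      obtain d'' where d'': "d'' \<in> H" "d'' \<subseteq> d" "d'' \<subseteq> d'" using HD(3)[OF d(1) d'(1)] by blast
      have all: "\<forall>(N, e)\<in>insert Ne I. \<forall>p\<in>N. AE \<omega> in M. rep (p (mdiff M dm g f)) \<omega> \<le> rep e \<omega>" if f: "f \<in> d''" for f
      proof -
        have "\<forall>(N, e)\<in>I. \<forall>p\<in>N. AE \<omega> in M. rep (p (mdiff M dm g f)) \<omega> \<le> rep e \<omega>" using d(3) d''(2) f by blast
        moreover have "\<forall>p\<in>N. AE \<omega> in M. rep (p (mdiff M dm g f)) \<omega> \<le> rep e \<omega>" using d'(2) d''(3) f by blast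
        ultimately show ?thesis by (simp add: Ne)
      qed
      show ?case
      proof (intro bexI[OF _ d''(1)] conjI)
        show "d'' \<subseteq> b" using d(2) d''(2) by blast
        show "\<forall>f\<in>d''. \<forall>(N, e)\<in>insert Ne I. \<forall>p\<in>N. AE \<omega> in M. rep (p (mdiff M dm g f)) \<omega> \<le> rep e \<omega>"
          by (rule ballI, rule all)
      qed
    qed
    then obtain d where d: "d \<in> H" "d \<subseteq> b" "\<forall>f\<in>d. \<forall>(N, e)\<in>I. \<forall>p\<in>N. AE \<omega> in M. rep (p (mdiff M dm g f)) \<omega> \<le> rep e \<omega>"
      by blast
    obtain f where f: "f \<in> d" using HD(2)[OF d(1)] by blast
    then have "f \<in> gauge_nbhd M dm I g"
      using d(3) polar_dual[OF HK[OF d(1) f]] by (simp add: gauge_nbhd_def mcarrier_dual)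
    then show "\<exists>y. y \<in> V \<and> y \<in> T" using I(2) f d(2) b(2) by blast
  qed
  then show ?thesis using gK unfolding cluster_point_def by blast
qed

lemma polar_stable_compact: "stable_compact M dm (sigma_s M E P) K"
proof -
  have "K \<subseteq> mcarrier dm" using polar_dual by (auto simp: mcarrier_dual)
  then have "stable_set M dm K" using polar_concat(1) by (simp add: stable_set_def)
  then show ?thesis using stable_filter_cluster_point by (simp add: stable_compact_def)
qed

end

theorem theorem6:
  fixes M :: "'a measure" and E :: "('a, 'e) l0mod"
    and P :: "('e \<Rightarrow> 'a L0) set" and U :: "'e set"
  assumes "prob_space M"
    and "l0_module M E"
    and "stable_module M E"
    and "\<forall>p\<in>P. l0_seminorm M E p"
    and "stable_family M E P"
    and "separated M E P"
    and "stable_set M E U"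
    and "neighbourhood (Ts M E P) (mzero E) U"
  shows "stable_compact M (dual_mod M E P) (sigma_s M E P) (polar M E P U)"
proof -
  interpret prob_space M by fact
  \<comment> \<open>A neighbourhood of zero places zero in some ball, and balls of the empty family
    are empty; so at least one seminorm exists.\<close>
  have "P \<noteq> {}"
  proof
    assume P: "P = {}"
    have "mzero E \<in> topspace (Ts M E P)" using assms(8) unfolding neighbourhood_def by blast
    then obtain N x r where N: "stable_finite M E P N" "mzero E \<in> sball M E N x r" by (auto simp: Ts_def)
    then show False using sballD(1)[OF N(2)] P by (simp add: stable_finite_def)
  qed
  then interpret l0_polar M E P U using assms by unfold_locales auto
  show ?thesis by (rule polar_stable_compact)
qed

end
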